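(* Let $s\ge1$, $l\in\{1,2\}$, and let $(A_0,\dots,A_{s-1})$ be an $s$-tuple of $\Sigma^0_l$-subsets of $\omega$. The following are equivalent. \begin{enumerate} \item $(A_0,\dots,A_{s-1})$ is $m$-complete in the class of $s$-tuples of $\Sigma^0_l$-sets. \item There exists a computable function $H:\omega^s\to\omega$ (a productive function) such that for all $x_0,\dots,x_{s-1}\in\omega$ $$H(x_0,\dots,x_{s-1})\in\bigcap_{i=0}^{s-1}\Big((A_i\cap W^{z_l}_{x_i})\cup(\overline{A_i}\cap\overline{W^{z_l}_{x_i}})\Big).$$ \item There exists an $s$-tuple of functions $(F_0,\dots,F_{s-1})$, $F_i:\omega^s\to\omega$, such that (a) $(F_0,\dots,F_{s-1})\le_m(A_0,\dots,A_{s-1})$, and (b) $W_{F_i(\bar x)}\not\sim_l W_{x_i}$ for all $0\le i<s$ and all $\bar x=(x_0,\dots,x_{s-1})\in\omega^s$. \item There exists an $s$-tuple of functions $(F_0,\dots,F_{s-1})$, $F_i:\omega^s\to\omega$, such that (a) $(F_0,\dots,F_{s-1})\le_m(A_0,\dots,A_{s-1})$, and (b) $\varphi_{F_i(\bar x)}\not\sim_l\varphi_{x_i}$ for all $0\le i<s$ and all $\bar x=(x_0,\dots,x_{s-1})\in\omega^s$. \end{enumerate}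
   Context: $\varphi_e$ is the unary partial computable function with Kleene index $e$, identified with its graph; $W_e=\mathrm{dom}(\varphi_e)$; for an oracle $z$, $W^z_e$ is the domain of the $e$-th partial function computable with oracle $z$. For $X\subseteq\omega$, $\overline X=\omega\setminus X$. The oracle $z_l$: $z_1=\emptyset$ (so $W^{z_1}_e=W_e$) and $z_2=\{n\mid\varphi_n(n)\downarrow\}$. The relation $\sim_l$: $A\sim_1B$ means $A=B$; $A\sim_2B$ means that $(A\setminus B)\cup(B\setminus A)$ is finite. Applied to partial functions, $\sim_l$ refers to their graphs. For $s$-tuples of sets, $(X_0,\dots,X_{s-1})\le_m(A_0,\dots,A_{s-1})$ means there is a total computable $f:\omega\to\omega$ with $n\in X_i\leftrightarrow f(n)\in A_i$ for all $n$ and all $i<s$. An $s$-tuple of $\Sigma^0_l$-sets is $m$-complete in the class of $s$-tuples of $\Sigma^0_l$-sets if every $s$-tuple of $\Sigma^0_l$-sets is $\le_m$ it. For an $s$-tuple of (not necessarily computable) total functions $F_i:\omega^s\to\omega$, $(F_0,\dots,F_{s-1})\le_m(A_0,\dots,A_{s-1})$ means there are total computable functions $h,a_i,b_i:\omega^s\to\omega$ ($0\le i\le s-1$) such that for all $\bar x$ and $i$: $F_i(\bar x)=a_i(\bar x)$ if $h(\bar x)\in A_i$, and $F_i(\bar x)=b_i(\bar x)$ if $h(\bar x)\notin A_i$. *)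

theory Defs
  imports Main "HOL-Library.Nat_Bijection"
begin

text \<open>
  \<open>kleene Z e xs y\<close> means that the partial function with index \<open>e\<close>, computed with oracle
  \<open>Z\<close>, converges on the argument tuple \<open>xs\<close> with value \<open>y\<close>. As in Kleene's
  schemata, an index is the code of a list consisting of a tag (zero, successor, projection, oracle,
  composition, primitive recursion, minimization) and the indices of the constituents. Numbers that
  are not of one of these forms are indices of the nowhere defined function. An index carries
  no arity: it may be applied to argument tuples of every length, and is undefined where a schema
  lacks an argument.
\<close>

inductive kleene :: "nat set \<Rightarrow> nat \<Rightarrow> nat list \<Rightarrow> nat \<Rightarrow> bool" for Z :: "nat set" where
  zero: "kleene Z (list_encode [0]) xs 0"
| succ: "kleene Z (list_encode [1]) (x # xs) (Suc x)"
| proj: "i < length xs \<Longrightarrow> kleene Z (list_encode [2, i]) xs (xs ! i)"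
| query: "kleene Z (list_encode [3]) (x # xs) (if x \<in> Z then 1 else 0)"
| comp: "list_all2 (\<lambda>g y. kleene Z g xs y) gs ys \<Longrightarrow> kleene Z f ys v \<Longrightarrow>
    kleene Z (list_encode [4, f, list_encode gs]) xs v"
| prec_0: "kleene Z f xs v \<Longrightarrow> kleene Z (list_encode [5, f, g]) (0 # xs) v"
| prec_Suc: "kleene Z (list_encode [5, f, g]) (n # xs) r \<Longrightarrow> kleene Z g (n # r # xs) v \<Longrightarrow>
    kleene Z (list_encode [5, f, g]) (Suc n # xs) v"
| mu: "kleene Z f (n # xs) 0 \<Longrightarrow> (\<And>m. m < n \<Longrightarrow> \<exists>v>0. kleene Z f (m # xs) v) \<Longrightarrow>
    kleene Z (list_encode [6, f]) xs n"

lemma kleene_iff: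
  "kleene Z (list_encode [0]) xs v \<longleftrightarrow> v = 0"
  "kleene Z (list_encode [1]) xs v \<longleftrightarrow> (\<exists>x ys. xs = x # ys \<and> v = Suc x)"
  "kleene Z (list_encode [2, i]) xs v \<longleftrightarrow> i < length xs \<and> v = xs ! i"
  "kleene Z (list_encode [3]) xs v \<longleftrightarrow> (\<exists>x ys. xs = x # ys \<and> v = (if x \<in> Z then 1 else 0))"
  "kleene Z (list_encode [4, f, list_encode gs]) xs v \<longleftrightarrow>
    (\<exists>ys. list_all2 (\<lambda>g y. kleene Z g xs y) gs ys \<and> kleene Z f ys v)"
  "kleene Z (list_encode [5, f, g]) (0 # xs) v \<longleftrightarrow> kleene Z f xs v"
  "kleene Z (list_encode [5, f, g]) (Suc n # xs) v \<longleftrightarrow>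
    (\<exists>r. kleene Z (list_encode [5, f, g]) (n # xs) r \<and> kleene Z g (n # r # xs) v)"
  "kleene Z (list_encode [6, f]) xs n \<longleftrightarrow>
    kleene Z f (n # xs) 0 \<and> (\<forall>m<n. \<exists>v>0. kleene Z f (m # xs) v)"
  by (subst kleene.simps, simp only: list_encode_eq list.inject, (auto simp del: list_encode.simps)[1])+

lemma kleene_deterministic: "kleene Z e xs v \<Longrightarrow> kleene Z e xs w \<Longrightarrow> v = w"
proof (induction arbitrary: w rule: kleene.induct)
  case (comp xs gs ys f v)
  from comp.prems obtain ys' where
    ys': "list_all2 (\<lambda>g y. kleene Z g xs y) gs ys'" and w: "kleene Z f ys' w"
    unfolding kleene_iff by blast
  have "ys = ys'"
    using comp.IH(1) ys' by (intro nth_equalityI) (auto simp: list_all2_conv_all_nth)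
  with w comp.IH show ?case by blast
next
  case (mu f n xs)
  from mu.prems have w0: "kleene Z f (w # xs) 0"
    and wl: "\<And>m. m < w \<Longrightarrow> \<exists>v>0. kleene Z f (m # xs) v"
    unfolding kleene_iff by blast+
  show ?case
  proof (rule linorder_cases[of n w])
    assume "n < w"
    with wl mu.IH(1) show ?thesis by (metis less_irrefl)
  next
    assume "w < n"
    with w0 mu.IH(2) show ?thesis by (metis less_irrefl)
  qed
next
  case (prec_Suc f g n xs r v)
  then show ?case unfolding kleene_iff by blast
qed (auto simp only: kleene_iff list.inject)

definition phi :: "nat set \<Rightarrow> nat \<Rightarrow> (nat \<times> nat) set" where
  "phi Z e = {(x, y). kleene Z e [x] y}"

lemma single_valued_phi: "single_valued (phi Z e)"
  by (auto simp: single_valued_def phi_def dest: kleene_deterministic)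

definition W :: "nat set \<Rightarrow> nat \<Rightarrow> nat set" where
  "W Z e = Domain (phi Z e)"

text \<open>
  A tuple of natural numbers is a list, and a function on \<open>k\<close>-tuples is a function on lists
  whose values on lists of other lengths are irrelevant. Computability without an oracle is
  computability with oracle \<open>{}\<close>.
\<close>

definition computable :: "nat \<Rightarrow> (nat list \<Rightarrow> nat) \<Rightarrow> bool" where
  "computable k f \<longleftrightarrow> (\<exists>e. \<forall>xs. length xs = k \<longrightarrow> kleene {} e xs (f xs))"

text \<open>
  \<open>Sigma0_rel n k R\<close>: the \<open>k\<close>-ary relation \<open>R\<close> is at the level \<open>n\<close> of
  the arithmetical hierarchy, i.e. it arises from a computable relation by a prefix of \<open>n\<close>
  alternating quantifiers that starts with an existential one.
\<close>

primrec Sigma0_rel :: "nat \<Rightarrow> nat \<Rightarrow> nat list set \<Rightarrow> bool" where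
  "Sigma0_rel 0 k R \<longleftrightarrow> computable k (\<lambda>xs. if xs \<in> R then 1 else 0)"
| "Sigma0_rel (Suc n) k R \<longleftrightarrow>
    (\<exists>Q. Sigma0_rel n (Suc k) Q \<and>
         (\<forall>xs. length xs = k \<longrightarrow> (xs \<in> R \<longleftrightarrow> (\<exists>y. y # xs \<notin> Q))))"

definition Sigma0 :: "nat \<Rightarrow> nat set \<Rightarrow> bool" where
  "Sigma0 l A \<longleftrightarrow> Sigma0_rel l 1 {[n] | n. n \<in> A}"

text \<open>The following two notions are only meant for \<open>l \<in> {1, 2}\<close>.\<close>

definition oracle_set :: "nat \<Rightarrow> nat set" where
  "oracle_set l = (if l = 1 then {} else {n. n \<in> W {} n})"

definition sim :: "nat \<Rightarrow> 'a set \<Rightarrow> 'a set \<Rightarrow> bool" where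
  "sim l A B \<longleftrightarrow> (if l = 1 then A = B else finite ((A - B) \<union> (B - A)))"

text \<open>
  An \<open>s\<close>-tuple of sets or of functions is a family indexed by \<open>nat\<close>, of which only the
  members with index below \<open>s\<close> matter.
\<close>

definition m_reducible_sets :: "nat \<Rightarrow> (nat \<Rightarrow> nat set) \<Rightarrow> (nat \<Rightarrow> nat set) \<Rightarrow> bool" where
  "m_reducible_sets s X A \<longleftrightarrow>
    (\<exists>f. computable 1 (\<lambda>xs. f (hd xs)) \<and> (\<forall>n. \<forall>i<s. n \<in> X i \<longleftrightarrow> f n \<in> A i))"

definition m_complete :: "nat \<Rightarrow> nat \<Rightarrow> (nat \<Rightarrow> nat set) \<Rightarrow> bool" where
  "m_complete l s A \<longleftrightarrow> (\<forall>i<s. Sigma0 l (A i)) \<and>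
    (\<forall>X. (\<forall>i<s. Sigma0 l (X i)) \<longrightarrow> m_reducible_sets s X A)"

definition m_reducible_funs ::
    "nat \<Rightarrow> (nat \<Rightarrow> nat list \<Rightarrow> nat) \<Rightarrow> (nat \<Rightarrow> nat set) \<Rightarrow> bool" where
  "m_reducible_funs s F A \<longleftrightarrow>
    (\<exists>h a b. computable s h \<and> (\<forall>i<s. computable s (a i) \<and> computable s (b i)) \<and>
      (\<forall>xs. length xs = s \<longrightarrow>
        (\<forall>i<s. F i xs = (if h xs \<in> A i then a i xs else b i xs))))"

end

theory Submission
  imports Defs
begin

text \<open>
  Write \<open>z\<close> for the oracle and call \<open>H\<close> productive if it has the property in the second statement.

  A complete tuple has a productive function because reductions can be made self-referential: in
  \<open>m_complete_imp_productive\<close>, the tuple to be reduced is allowed to evaluate any candidate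
  \<open>\<phi>\<^sub>e\<close> for its own reduction. Conversely, a productive \<open>H\<close> turns indices \<open>g\<^sub>i(n)\<close>, obtained from
  the parameter theorem, of sets that are \<open>\<omega>\<close> or empty according to whether \<open>n \<in> X\<^sub>i\<close>, into a
  reduction of \<open>X\<close> to \<open>A\<close> (\<open>productive_imp_m_complete\<close>). For \<open>l = 2\<close> both directions rest
  on Post's theorem: the \<open>\<Sigma>\<^sup>0\<^sub>2\<close> sets are uniformly the sets computably enumerable in the halting
  problem (\<open>sigma_W_2\<close>, \<open>ex_index_of_sigma_2\<close>).

  A complete tuple computes fixed-point free functions that choose between two fixed indices, those
  of \<open>\<omega>\<close> and of the empty set; the choice depends on whether the given set is nonempty (for
  \<open>l = 1\<close>) or finite (for \<open>l = 2\<close>), which are properties of level \<open>l\<close>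
  (\<open>ex_sigma_separation\<close>). Functions that avoid \<open>\<sim>\<^sub>l\<close> on domains avoid it on graphs, since
  similar graphs have similar domains.

  The main step is from fixed-point free functions on graphs back to completeness
  (\<open>fixed_point_free_imp_m_complete\<close>). By the recursion theorem a tuple of indices
  \<open>x\<^sub>i\<close> can be found for which a race between the two events \<open>n \<in> X\<^sub>i\<close> and \<open>h(x) \<in> A\<^sub>i\<close>
  decides which function \<open>x\<^sub>i\<close> computes: if only the first event takes place, it is, up to \<open>\<sim>\<^sub>l\<close>,
  the one with index \<open>b\<^sub>i(x)\<close>, and if only the second one does, the one with index \<open>a\<^sub>i(x)\<close>. In
  both cases \<open>x\<^sub>i\<close> would be a fixed point of \<open>F\<^sub>i\<close>, so the two events are equivalent. For
  \<open>l = 1\<close> the race is a search for the first event to be confirmed; for \<open>l = 2\<close> it is a guess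
  made afresh at each argument, which is wrong only finitely often (\<open>ex_sigma_race\<close>).

  All of this needs a universal function, the T-predicate and the arithmetical complexity of
  convergence. They are obtained from a coding of finite computations as lists of claims
  (\<open>kleene_iff_derivation\<close>), in which an oracle enters only through the correctness of the
  recorded answers.
\<close>

text \<open>
  Indices are kept in the form \<open>list_encode [\<dots>]\<close>, on which the characteristic equations of
  \<open>kleene\<close> operate.
\<close>

declare list_encode.simps [simp del] list_decode.simps [simp del]

section \<open>Total functions computable in an oracle\<close>

text \<open>
  \<open>f\<close> is a total \<open>k\<close>-ary function computable with oracle \<open>Z\<close>; as for tuples in
  general, the values of \<open>f\<close> at lists of a length other than \<open>k\<close> do not matter.
\<close>

definition computable_in :: "nat set \<Rightarrow> nat \<Rightarrow> (nat list \<Rightarrow> nat) \<Rightarrow> bool" where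
  "computable_in Z k f \<longleftrightarrow> (\<exists>e. \<forall>xs. length xs = k \<longrightarrow> kleene Z e xs (f xs))"

lemma computable_iff_computable_in: "computable k f \<longleftrightarrow> computable_in {} k f"
  by (simp add: computable_def computable_in_def)

lemma computable_in_cong:
  assumes "computable_in Z k f" "\<And>xs. length xs = k \<Longrightarrow> f xs = g xs"
  shows "computable_in Z k g"
  using assms unfolding computable_in_def by metis

lemma computable_in_nth: "i < k \<Longrightarrow> computable_in Z k (\<lambda>xs. xs ! i)"
  unfolding computable_in_def by (metis kleene.proj)

lemma computable_in_comp:
  assumes "computable_in Z (length gs) f" "\<And>g. g \<in> set gs \<Longrightarrow> computable_in Z k g"
  shows "computable_in Z k (\<lambda>xs. f (map (\<lambda>g. g xs) gs))"
proof -
  obtain e where e: "\<And>ys. length ys = length gs \<Longrightarrow> kleene Z e ys (f ys)"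
    using assms(1) unfolding computable_in_def by blast
  obtain d where d: "\<And>g xs. g \<in> set gs \<Longrightarrow> length xs = k \<Longrightarrow> kleene Z (d g) xs (g xs)"
    using assms(2) unfolding computable_in_def by metis
  have "kleene Z (list_encode [4, e, list_encode (map d gs)]) xs (f (map (\<lambda>g. g xs) gs))"
    if "length xs = k" for xs
    using that by (intro kleene.comp[where ys = "map (\<lambda>g. g xs) gs"] e)
      (auto simp: list_all2_conv_all_nth d)
  then show ?thesis unfolding computable_in_def by blast
qed

lemma computable_in_comp1:
  assumes "computable_in Z 1 (\<lambda>xs. f (xs ! 0))" "computable_in Z k g"
  shows "computable_in Z k (\<lambda>xs. f (g xs))"
  using computable_in_comp[of Z "[g]" "\<lambda>xs. f (xs ! 0)" k] assms by simp

lemma computable_in_comp2: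
  assumes "computable_in Z 2 (\<lambda>xs. f (xs ! 0) (xs ! 1))" "computable_in Z k g" "computable_in Z k h"
  shows "computable_in Z k (\<lambda>xs. f (g xs) (h xs))"
  using computable_in_comp[of Z "[g, h]" "\<lambda>xs. f (xs ! 0) (xs ! 1)" k] assms
  by (auto simp: numeral_2_eq_2)

lemma computable_in_zero: "computable_in Z k (\<lambda>xs. 0)"
  unfolding computable_in_def using kleene.zero by blast

lemma computable_in_Suc: "computable_in Z k f \<Longrightarrow> computable_in Z k (\<lambda>xs. Suc (f xs))"
proof (rule computable_in_comp1[of Z Suc])
  have "kleene Z (list_encode [1]) xs (Suc (xs ! 0))" if "length xs = 1" for xs
    using that kleene.succ by (cases xs) auto
  then show "computable_in Z 1 (\<lambda>xs. Suc (xs ! 0))" unfolding computable_in_def by blast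
qed

lemma computable_in_const: "computable_in Z k (\<lambda>xs. c)"
  by (induction c) (auto intro: computable_in_zero computable_in_Suc)

lemma computable_in_prec:
  assumes "computable_in Z k f" "computable_in Z (Suc (Suc k)) g"
  shows "computable_in Z (Suc k) (\<lambda>xs. rec_nat (f (tl xs)) (\<lambda>n r. g (n # r # tl xs)) (xs ! 0))"
proof -
  obtain a b where a: "\<And>xs. length xs = k \<Longrightarrow> kleene Z a xs (f xs)"
    and b: "\<And>xs. length xs = Suc (Suc k) \<Longrightarrow> kleene Z b xs (g xs)"
    using assms unfolding computable_in_def by blast
  have *: "kleene Z (list_encode [5, a, b]) (n # xs) (rec_nat (f xs) (\<lambda>n r. g (n # r # xs)) n)"
    if "length xs = k" for xs n
  proof (induction n)
    case 0
    then show ?case using a[OF that] by (auto intro: kleene.prec_0)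
  next
    case (Suc n)
    show ?case using kleene.prec_Suc[OF Suc.IH b] that by simp
  qed
  have "kleene Z (list_encode [5, a, b]) xs
      (rec_nat (f (tl xs)) (\<lambda>n r. g (n # r # tl xs)) (xs ! 0))" if "length xs = Suc k" for xs
    using *[of "tl xs" "hd xs"] that by (cases xs) auto
  then show ?thesis unfolding computable_in_def by blast
qed

lemma kleene_mu_iff:
  assumes "\<And>n. kleene Z e (n # xs) (f n)"
  shows "kleene Z (list_encode [6, e]) xs n \<longleftrightarrow> f n = 0 \<and> (\<forall>m<n. f m \<noteq> 0)"
proof -
  have "kleene Z e (m # xs) v \<longleftrightarrow> v = f m" for m v
    using assms kleene_deterministic by blast
  then show ?thesis unfolding kleene_iff by auto
qed

lemma computable_in_mu:
  assumes "computable_in Z (Suc k) f" "\<And>xs. length xs = k \<Longrightarrow> \<exists>n. f (n # xs) = 0"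
  shows "computable_in Z k (\<lambda>xs. LEAST n. f (n # xs) = 0)"
proof -
  obtain e where e: "\<And>xs. length xs = Suc k \<Longrightarrow> kleene Z e xs (f xs)"
    using assms unfolding computable_in_def by blast
  have "kleene Z (list_encode [6, e]) xs (LEAST n. f (n # xs) = 0)" if "length xs = k" for xs
    using assms(2)[OF that] e that
    by (subst kleene_mu_iff[where f = "\<lambda>n. f (n # xs)"]) (auto intro: LeastI dest: not_less_Least)
  then show ?thesis unfolding computable_in_def by blast
qed

section \<open>Arithmetic and the pairing function\<close>

text \<open>
  Primitive recursion in the form in which the arithmetical operations use it: recursion on the
  first of two arguments.
\<close>

lemma computable_in_binary_rec:
  assumes "computable_in Z 1 f" "computable_in Z 3 g"
    and "\<And>x. F 0 x = f [x]" "\<And>n x. F (Suc n) x = g [n, F n x, x]"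
  shows "computable_in Z 2 (\<lambda>xs. F (xs ! 0) (xs ! 1))"
proof -
  have F: "F n x = rec_nat (f [x]) (\<lambda>n r. g [n, r, x]) n" for n x
    by (induction n) (auto simp: assms(3,4))
  have "computable_in Z (Suc 1) (\<lambda>xs. rec_nat (f (tl xs)) (\<lambda>n r. g (n # r # tl xs)) (xs ! 0))"
    using assms(1,2) by (intro computable_in_prec) (simp_all add: eval_nat_numeral)
  then show ?thesis unfolding numeral_2_eq_2 One_nat_def
    by (rule computable_in_cong) (auto simp: length_Suc_conv F)
qed

lemma computable_in_add:
  assumes "computable_in Z k f" "computable_in Z k g"
  shows "computable_in Z k (\<lambda>xs. f xs + g xs)"
proof (rule computable_in_comp2[where f = "(+)", OF _ assms])
  show "computable_in Z 2 (\<lambda>xs. xs ! 0 + xs ! 1)"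
    by (rule computable_in_binary_rec[where F = "(+)" and f = "\<lambda>xs. xs ! 0" and g = "\<lambda>xs. Suc (xs ! 1)"])
      (auto intro!: computable_in_nth computable_in_Suc)
qed

lemma computable_in_pred:
  assumes "computable_in Z k f" shows "computable_in Z k (\<lambda>xs. f xs - 1)"
proof (rule computable_in_comp2[where f = "\<lambda>x y. x - 1", OF _ assms assms])
  show "computable_in Z 2 (\<lambda>xs. xs ! 0 - 1)"
    by (rule computable_in_binary_rec[where F = "\<lambda>x y. x - 1" and f = "\<lambda>xs. 0" and g = "\<lambda>xs. xs ! 0"])
      (auto intro: computable_in_nth computable_in_zero)
qed

lemma computable_in_diff:
  assumes "computable_in Z k f" "computable_in Z k g"
  shows "computable_in Z k (\<lambda>xs. f xs - g xs)"
proof (rule computable_in_comp2[where f = "\<lambda>x y. y - x", OF _ assms(2,1)])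
  show "computable_in Z 2 (\<lambda>xs. xs ! 1 - xs ! 0)"
    by (rule computable_in_binary_rec[where F = "\<lambda>x y. y - x" and f = "\<lambda>xs. xs ! 0" and g = "\<lambda>xs. xs ! 1 - 1"])
      (simp_all add: computable_in_nth computable_in_pred del: One_nat_def)
qed

lemma computable_in_triangle:
  assumes "computable_in Z k f" shows "computable_in Z k (\<lambda>xs. triangle (f xs))"
proof (rule computable_in_comp2[where f = "\<lambda>x y. triangle x", OF _ assms assms])
  show "computable_in Z 2 (\<lambda>xs. triangle (xs ! 0))"
    by (rule computable_in_binary_rec[where F = "\<lambda>x y. triangle x" and f = "\<lambda>xs. 0"
          and g = "\<lambda>xs. xs ! 1 + Suc (xs ! 0)"])
      (auto intro!: computable_in_nth computable_in_zero computable_in_Suc computable_in_add)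
qed

lemma computable_in_prod_encode:
  assumes "computable_in Z k f" "computable_in Z k g"
  shows "computable_in Z k (\<lambda>xs. prod_encode (f xs, g xs))"
  unfolding prod_encode_def
  by (simp add: assms computable_in_triangle computable_in_add)

text \<open>
  The two projections that invert the pairing function.
\<close>

definition pfst :: "nat \<Rightarrow> nat" where "pfst n = fst (prod_decode n)"
definition psnd :: "nat \<Rightarrow> nat" where "psnd n = snd (prod_decode n)"

lemma pfst_prod_encode [simp]: "pfst (prod_encode (a, b)) = a"
  by (simp add: pfst_def)

lemma psnd_prod_encode [simp]: "psnd (prod_encode (a, b)) = b"
  by (simp add: psnd_def)

lemma prod_encode_pfst_psnd [simp]: "prod_encode (pfst n, psnd n) = n"
  by (simp add: pfst_def psnd_def)

lemma triangle_mono: "m \<le> n \<Longrightarrow> triangle m \<le> triangle n"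
  by (induction n) (auto simp: le_Suc_eq)

text \<open>
  The code of \<open>(a, b)\<close> is \<open>triangle (a + b) + a\<close>, which lies strictly below
  \<open>triangle (a + b + 1)\<close>. So \<open>a + b\<close> is found by an unbounded search, and \<open>a\<close> and
  \<open>b\<close> are then found by subtraction.
\<close>

lemma pfst_plus_psnd_eq_Least: "pfst n + psnd n = (LEAST k. Suc n - triangle (Suc k) = 0)"
proof -
  have n: "n = triangle (pfst n + psnd n) + pfst n"
    using prod_encode_pfst_psnd[of n] unfolding prod_encode_def by simp
  show ?thesis
  proof (rule Least_equality[symmetric])
    show "Suc n - triangle (Suc (pfst n + psnd n)) = 0" using n by simp
  next
    fix k assume "Suc n - triangle (Suc k) = 0"
    then have "n < triangle (Suc k)" by simp
    then show "pfst n + psnd n \<le> k"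
      using n triangle_mono[of "Suc k" "pfst n + psnd n"] by (metis leD le_add1 le_trans not_less_eq_eq)
  qed
qed

lemma computable_in_pfst_plus_psnd:
  "computable_in Z 1 (\<lambda>xs. pfst (xs ! 0) + psnd (xs ! 0))"
proof -
  have "computable_in Z 1 (\<lambda>xs. LEAST k. (\<lambda>xs. Suc (xs ! 1) - triangle (Suc (xs ! 0))) (k # xs) = 0)"
  proof (rule computable_in_mu)
    fix xs :: "nat list"
    show "\<exists>n. Suc ((n # xs) ! 1) - triangle (Suc ((n # xs) ! 0)) = 0"
      by (rule exI[of _ "xs ! 0"]) simp
  qed (intro computable_in_nth computable_in_Suc computable_in_triangle computable_in_diff; simp)
  then show ?thesis by (simp add: pfst_plus_psnd_eq_Least)
qed

lemma computable_in_pfst: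
  assumes "computable_in Z k f" shows "computable_in Z k (\<lambda>xs. pfst (f xs))"
proof (rule computable_in_comp1[where f = pfst, OF _ assms])
  have *: "n - triangle (pfst n + psnd n) = pfst n" for n
    using arg_cong[OF prod_encode_pfst_psnd[of n], of "\<lambda>m. m - triangle (pfst n + psnd n)"]
    unfolding prod_encode_def by simp
  have "computable_in Z 1 (\<lambda>xs. xs ! 0 - triangle (pfst (xs ! 0) + psnd (xs ! 0)))"
    by (intro computable_in_diff computable_in_triangle computable_in_pfst_plus_psnd
        computable_in_nth) simp
  then show "computable_in Z 1 (\<lambda>xs. pfst (xs ! 0))" unfolding * .
qed

lemma computable_in_psnd:
  assumes "computable_in Z k f" shows "computable_in Z k (\<lambda>xs. psnd (f xs))"
proof (rule computable_in_comp1[where f = psnd, OF _ assms])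
  have "computable_in Z 1 (\<lambda>xs. (pfst (xs ! 0) + psnd (xs ! 0)) - pfst (xs ! 0))"
    by (intro computable_in_diff computable_in_pfst_plus_psnd computable_in_pfst computable_in_nth) simp
  then show "computable_in Z 1 (\<lambda>xs. psnd (xs ! 0))" by simp
qed

section \<open>Recursive functions and decidable predicates of one argument\<close>

text \<open>
  Unary functions and predicates suffice for the arguments below, because several arguments are
  passed as one number by nested pairing. This has the advantage that the closure properties need
  no arities: a bound variable is an iterated projection of the single argument.
\<close>

definition recursive_in :: "nat set \<Rightarrow> (nat \<Rightarrow> nat) \<Rightarrow> bool" where
  "recursive_in Z f \<longleftrightarrow> (\<exists>e. \<forall>x. kleene Z e [x] (f x))"

definition decidable_in :: "nat set \<Rightarrow> (nat \<Rightarrow> bool) \<Rightarrow> bool" where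
  "decidable_in Z P \<longleftrightarrow> recursive_in Z (\<lambda>x. if P x then 1 else 0)"

lemma recursive_in_iff: "recursive_in Z f \<longleftrightarrow> computable_in Z 1 (\<lambda>xs. f (xs ! 0))"
proof -
  have "(\<forall>x. kleene Z e [x] (f x)) \<longleftrightarrow> (\<forall>xs. length xs = 1 \<longrightarrow> kleene Z e xs (f (xs ! 0)))" for e
    by (auto simp: length_Suc_conv)
  then show ?thesis unfolding recursive_in_def computable_in_def by simp
qed

lemma recursive_in_const: "recursive_in Z (\<lambda>x. c)"
  unfolding recursive_in_iff by (rule computable_in_const)

lemma recursive_in_id: "recursive_in Z (\<lambda>x. x)"
  unfolding recursive_in_iff by (rule computable_in_nth) simp

lemma recursive_in_comp:
  assumes "recursive_in Z f" "recursive_in Z g" shows "recursive_in Z (\<lambda>x. f (g x))"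
  using assms computable_in_comp1 unfolding recursive_in_iff by blast

lemma decidable_in_comp:
  "decidable_in Z P \<Longrightarrow> recursive_in Z g \<Longrightarrow> decidable_in Z (\<lambda>x. P (g x))"
  unfolding decidable_in_def by (rule recursive_in_comp)

lemma recursive_in_Suc: "recursive_in Z f \<Longrightarrow> recursive_in Z (\<lambda>x. Suc (f x))"
  unfolding recursive_in_iff by (rule computable_in_Suc)

lemma recursive_in_add:
  "recursive_in Z f \<Longrightarrow> recursive_in Z g \<Longrightarrow> recursive_in Z (\<lambda>x. f x + g x)"
  unfolding recursive_in_iff by (rule computable_in_add)

lemma recursive_in_diff:
  "recursive_in Z f \<Longrightarrow> recursive_in Z g \<Longrightarrow> recursive_in Z (\<lambda>x. f x - g x)"
  unfolding recursive_in_iff by (rule computable_in_diff)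

lemma recursive_in_prod_encode:
  "recursive_in Z f \<Longrightarrow> recursive_in Z g \<Longrightarrow> recursive_in Z (\<lambda>x. prod_encode (f x, g x))"
  unfolding recursive_in_iff by (rule computable_in_prod_encode)

lemma recursive_in_pfst: "recursive_in Z f \<Longrightarrow> recursive_in Z (\<lambda>x. pfst (f x))"
  unfolding recursive_in_iff by (rule computable_in_pfst)

lemma recursive_in_psnd: "recursive_in Z f \<Longrightarrow> recursive_in Z (\<lambda>x. psnd (f x))"
  unfolding recursive_in_iff by (rule computable_in_psnd)

text \<open>
  In the second assumption the argument \<open>z\<close> codes the triple of the recursion variable, the
  previous value and the parameter.
\<close>

lemma recursive_in_rec_nat:
  assumes "recursive_in Z f" "recursive_in Z (\<lambda>z. g (pfst z) (pfst (psnd z)) (psnd (psnd z)))"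
    "recursive_in Z n"
  shows "recursive_in Z (\<lambda>x. rec_nat (f x) (\<lambda>i r. g i r x) (n x))"
proof -
  have *: "computable_in Z 2 (\<lambda>xs. rec_nat (f (xs ! 1)) (\<lambda>i r. g i r (xs ! 1)) (xs ! 0))"
  proof (rule computable_in_binary_rec[where f = "\<lambda>xs. f (xs ! 0)"
        and g = "\<lambda>xs. g (xs ! 0) (xs ! 1) (xs ! 2)" and F = "\<lambda>n x. rec_nat (f x) (\<lambda>i r. g i r x) n"])
    let ?g = "\<lambda>z. g (pfst z) (pfst (psnd z)) (psnd (psnd z))"
    have "computable_in Z 3 (\<lambda>xs. ?g (prod_encode (xs ! 0, prod_encode (xs ! 1, xs ! 2))))"
      using assms(2) unfolding recursive_in_iff
      by (rule computable_in_comp1[of Z ?g])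
        (intro computable_in_prod_encode computable_in_nth; simp)
    then show "computable_in Z 3 (\<lambda>xs. g (xs ! 0) (xs ! 1) (xs ! 2))" by simp
  qed (use assms in \<open>auto simp: recursive_in_iff\<close>)
  show ?thesis
    using computable_in_comp2[OF * assms(3)[unfolded recursive_in_iff] computable_in_nth[of 0 1 Z]]
    unfolding recursive_in_iff by simp
qed

lemma recursive_in_if:
  assumes "decidable_in Z P" "recursive_in Z f" "recursive_in Z g"
  shows "recursive_in Z (\<lambda>x. if P x then f x else g x)"
proof -
  have "recursive_in Z (\<lambda>x. rec_nat (g x) (\<lambda>i r. f x) (if P x then 1 else 0))"
  proof (rule recursive_in_rec_nat[where g = "\<lambda>i r x. f x"])
    show "recursive_in Z (\<lambda>z. f (psnd (psnd z)))"
      by (intro recursive_in_comp[OF assms(2)] recursive_in_psnd recursive_in_id)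
  qed (use assms in \<open>simp_all add: decidable_in_def\<close>)
  moreover have "rec_nat (g x) (\<lambda>i r. f x) (if P x then 1 else 0) = (if P x then f x else g x)" for x
    by simp
  ultimately show ?thesis by simp
qed

lemma decidable_in_not:
  assumes "decidable_in Z P" shows "decidable_in Z (\<lambda>x. \<not> P x)"
proof -
  have "(if P x then 0 else 1) = (if \<not> P x then 1 else (0::nat))" for x by simp
  then show ?thesis
    using recursive_in_if[OF assms recursive_in_const[of Z 0] recursive_in_const[of Z 1]]
    unfolding decidable_in_def by (simp only:)
qed

lemma decidable_in_conj:
  assumes "decidable_in Z P" "decidable_in Z Q" shows "decidable_in Z (\<lambda>x. P x \<and> Q x)"
proof -
  have "(if P x then if Q x then 1 else 0 else 0) = (if P x \<and> Q x then 1 else (0::nat))" for x by simp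
  then show ?thesis
    using recursive_in_if[OF assms(1) assms(2)[unfolded decidable_in_def] recursive_in_const[of Z 0]]
    unfolding decidable_in_def by (simp only:)
qed

lemma decidable_in_disj:
  assumes "decidable_in Z P" "decidable_in Z Q" shows "decidable_in Z (\<lambda>x. P x \<or> Q x)"
proof -
  have "decidable_in Z (\<lambda>x. \<not> (\<not> P x \<and> \<not> Q x))"
    by (rule decidable_in_not, rule decidable_in_conj; rule decidable_in_not, rule assms)
  then show ?thesis by simp
qed

lemma decidable_in_imp:
  assumes "decidable_in Z P" "decidable_in Z Q" shows "decidable_in Z (\<lambda>x. P x \<longrightarrow> Q x)"
  unfolding imp_conv_disj by (rule decidable_in_disj[OF decidable_in_not[OF assms(1)] assms(2)])

lemma decidable_in_less:
  assumes "recursive_in Z f" "recursive_in Z g"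
  shows "decidable_in Z (\<lambda>x. f x < g x)"
proof -
  have "recursive_in Z (\<lambda>x. 1 - (1 - (g x - f x)))"
    by (intro recursive_in_diff recursive_in_const assms)
  moreover have "1 - (1 - (g x - f x)) = (if f x < g x then 1 else 0)" for x by simp
  ultimately show ?thesis unfolding decidable_in_def by simp
qed

lemma decidable_in_le:
  assumes "recursive_in Z f" "recursive_in Z g" shows "decidable_in Z (\<lambda>x. f x \<le> g x)"
  unfolding not_less[symmetric] by (intro decidable_in_not decidable_in_less assms)

lemma decidable_in_eq:
  fixes f g :: "nat \<Rightarrow> nat"
  assumes "recursive_in Z f" "recursive_in Z g" shows "decidable_in Z (\<lambda>x. f x = g x)"
  unfolding order_eq_iff by (intro decidable_in_conj decidable_in_le assms)

lemma decidable_in_bex: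
  assumes "recursive_in Z n" "decidable_in Z (\<lambda>z. P (pfst z) (psnd z))"
  shows "decidable_in Z (\<lambda>x. \<exists>i<n x. P i x)"
proof -
  have "recursive_in Z (\<lambda>x. rec_nat 0 (\<lambda>i r. if P i x then 1 else r) (n x))"
  proof (rule recursive_in_rec_nat[OF recursive_in_const _ assms(1)])
    have "decidable_in Z (\<lambda>z. (\<lambda>z. P (pfst z) (psnd z)) (prod_encode (pfst z, psnd (psnd z))))"
      by (intro decidable_in_comp[OF assms(2)] recursive_in_prod_encode recursive_in_pfst
          recursive_in_psnd recursive_in_id)
    then show "recursive_in Z (\<lambda>z. if P (pfst z) (psnd (psnd z)) then 1 else pfst (psnd z))"
      by (intro recursive_in_if recursive_in_const recursive_in_pfst
          recursive_in_psnd recursive_in_id) simp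
  qed
  moreover have "rec_nat 0 (\<lambda>i r. if P i x then 1 else r) n = (if \<exists>i<n. P i x then 1 else (0::nat))" for n x
    by (induction n) (auto simp: less_Suc_eq)
  ultimately show ?thesis unfolding decidable_in_def by simp
qed

lemma decidable_in_ball:
  assumes "recursive_in Z n" "decidable_in Z (\<lambda>z. P (pfst z) (psnd z))"
  shows "decidable_in Z (\<lambda>x. \<forall>i<n x. P i x)"
  using decidable_in_not[OF decidable_in_bex[where P = "\<lambda>i x. \<not> P i x",
        OF assms(1) decidable_in_not[OF assms(2)]]] by simp

lemmas recursive_intros =
  recursive_in_const recursive_in_id recursive_in_Suc recursive_in_add recursive_in_diff
  recursive_in_prod_encode recursive_in_pfst recursive_in_psnd recursive_in_if
  decidable_in_not decidable_in_conj decidable_in_disj decidable_in_imp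
  decidable_in_less decidable_in_le decidable_in_eq decidable_in_bex decidable_in_ball

section \<open>Operations on codes of lists\<close>

text \<open>
  Head, tail, suffixes and entries of a list, computed on its code. As \<open>list_encode (x # xs)\<close> is
  the successor of a pair and \<open>list_encode [] = 0\<close>, the tail of the code \<open>0\<close> is \<open>0\<close>, and
  entries beyond the end of the list have a value of no significance.
\<close>

definition code_hd :: "nat \<Rightarrow> nat" where "code_hd c = pfst (c - 1)"
definition code_tl :: "nat \<Rightarrow> nat" where "code_tl c = psnd (c - 1)"

definition code_drop :: "nat \<Rightarrow> nat \<Rightarrow> nat" where
  "code_drop i c = rec_nat c (\<lambda>_. code_tl) i"

definition code_nth :: "nat \<Rightarrow> nat \<Rightarrow> nat" where
  "code_nth c i = code_hd (code_drop i c)"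

lemma code_hd_list_encode [simp]: "code_hd (list_encode (x # xs)) = x"
  by (simp add: code_hd_def list_encode.simps)

lemma code_tl_list_encode [simp]: "code_tl (list_encode xs) = list_encode (tl xs)"
proof (cases xs)
  case Nil
  then show ?thesis
    using le_prod_encode_2[of "psnd 0" "pfst 0"] by (simp add: code_tl_def list_encode.simps)
qed (simp add: code_tl_def list_encode.simps)

lemma code_drop_list_encode [simp]: "code_drop i (list_encode xs) = list_encode (drop i xs)"
  unfolding code_drop_def by (induction i) (auto simp: drop_Suc tl_drop)

lemma code_nth_list_encode [simp]: "i < length xs \<Longrightarrow> code_nth (list_encode xs) i = xs ! i"
  unfolding code_nth_def by (simp add: Cons_nth_drop_Suc[symmetric])

lemma list_encode_eq_0_iff [simp]: "list_encode xs = 0 \<longleftrightarrow> xs = []"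
  using list_encode_eq[of xs "[]"] by (simp add: list_encode.simps)

lemma length_le_list_encode: "length xs \<le> list_encode xs"
  by (induction xs) (auto simp: list_encode.simps intro: le_trans[OF _ le_prod_encode_2])

lemma length_list_decode_le: "length (list_decode c) \<le> c"
  using length_le_list_encode[of "list_decode c"] by simp

lemma code_drop_eq_0_iff [simp]: "code_drop i c = 0 \<longleftrightarrow> length (list_decode c) \<le> i"
  using code_drop_list_encode[of i "list_decode c"] by simp

lemma code_nth_eq: "i < length (list_decode c) \<Longrightarrow> code_nth c i = list_decode c ! i"
  using code_nth_list_encode[of i "list_decode c"] by simp

lemma recursive_in_code_hd: "recursive_in Z f \<Longrightarrow> recursive_in Z (\<lambda>x. code_hd (f x))"
  unfolding code_hd_def by (intro recursive_intros)

lemma recursive_in_code_tl: "recursive_in Z f \<Longrightarrow> recursive_in Z (\<lambda>x. code_tl (f x))"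
  unfolding code_tl_def by (intro recursive_intros)

lemma recursive_in_code_drop:
  "recursive_in Z f \<Longrightarrow> recursive_in Z g \<Longrightarrow> recursive_in Z (\<lambda>x. code_drop (g x) (f x))"
  unfolding code_drop_def by (intro recursive_intros recursive_in_rec_nat recursive_in_code_tl)

lemma recursive_in_code_nth:
  "recursive_in Z f \<Longrightarrow> recursive_in Z g \<Longrightarrow> recursive_in Z (\<lambda>x. code_nth (f x) (g x))"
  unfolding code_nth_def by (intro recursive_in_code_hd recursive_in_code_drop)

lemma recursive_in_list_encode_Nil: "recursive_in Z (\<lambda>x. list_encode [])"
  by (rule recursive_in_const)

lemma recursive_in_list_encode_Cons:
  "recursive_in Z f \<Longrightarrow> recursive_in Z (\<lambda>x. list_encode (g x)) \<Longrightarrow>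
    recursive_in Z (\<lambda>x. list_encode (f x # g x))"
  unfolding list_encode.simps by (intro recursive_intros)

lemma recursive_in_list_encode_list_decode:
  "recursive_in Z f \<Longrightarrow> recursive_in Z (\<lambda>x. list_encode (list_decode (f x)))"
  by simp

lemma decidable_in_ex_mem:
  assumes "recursive_in Z f" "decidable_in Z (\<lambda>z. P (pfst z) (psnd z))"
  shows "decidable_in Z (\<lambda>x. \<exists>t\<in>set (list_decode (f x)). P t x)"
proof -
  have *: "(\<exists>t\<in>set (list_decode c). P t x) \<longleftrightarrow>
      (\<exists>i<c. code_drop i c \<noteq> 0 \<and> P (code_nth c i) x)" for c x
  proof
    assume "\<exists>t\<in>set (list_decode c). P t x"
    then obtain i where "i < length (list_decode c)" "P (code_nth c i) x"
      by (auto simp: in_set_conv_nth code_nth_eq)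
    with length_list_decode_le[of c] show "\<exists>i<c. code_drop i c \<noteq> 0 \<and> P (code_nth c i) x"
      by (intro exI[of _ i]) simp
  qed (auto simp: code_nth_eq not_le intro: nth_mem)
  have "decidable_in Z (\<lambda>z. (\<lambda>z. P (pfst z) (psnd z))
      (prod_encode (code_nth (f (psnd z)) (pfst z), psnd z)))"
    by (intro decidable_in_comp[OF assms(2)] recursive_in_comp[OF assms(1)] recursive_in_code_nth
        recursive_intros)
  then show ?thesis unfolding *
    by (intro recursive_intros recursive_in_code_drop recursive_in_comp[OF assms(1)] assms(1)) simp
qed

lemma decidable_in_mem:
  assumes "recursive_in Z f" "recursive_in Z g"
  shows "decidable_in Z (\<lambda>x. f x \<in> set (list_decode (g x)))"
proof -
  have "decidable_in Z (\<lambda>x. \<exists>t\<in>set (list_decode (g x)). t = f x)"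
    by (intro decidable_in_ex_mem recursive_intros recursive_in_comp[OF assms(1)] assms(2))
  then show ?thesis by simp
qed

lemma decidable_in_list_all2:
  assumes "recursive_in Z f" "recursive_in Z g"
    and "decidable_in Z (\<lambda>z. P (pfst z) (pfst (psnd z)) (psnd (psnd z)))"
  shows "decidable_in Z (\<lambda>x. list_all2 (\<lambda>a b. P a b x) (list_decode (f x)) (list_decode (g x)))"
proof -
  have *: "list_all2 (\<lambda>a b. P a b x) (list_decode c) (list_decode d) \<longleftrightarrow>
      (\<forall>i<c + d. (code_drop i c = 0 \<longrightarrow> code_drop i d = 0) \<and> (code_drop i d = 0 \<longrightarrow> code_drop i c = 0) \<and>
         (code_drop i c = 0 \<or> P (code_nth c i) (code_nth d i) x))" (is "?L \<longleftrightarrow> ?R") for c d x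
  proof
    assume ?L
    then show ?R
      by (auto simp: list_all2_conv_all_nth code_nth_eq leI)
        (metis code_nth_eq leI)
  next
    assume R: ?R
    have "length (list_decode d) \<le> length (list_decode c)"
    proof (rule ccontr)
      assume "\<not> ?thesis"
      with spec[OF R, of "length (list_decode c)"] length_list_decode_le[of d] show False by simp
    qed
    moreover have "length (list_decode c) \<le> length (list_decode d)"
    proof (rule ccontr)
      assume "\<not> ?thesis"
      with spec[OF R, of "length (list_decode d)"] length_list_decode_le[of c] show False by simp
    qed
    ultimately have "length (list_decode c) = length (list_decode d)" by simp
    moreover have "i < c + d" if "i < length (list_decode c)" for i
      using that length_list_decode_le[of c] by simp
    ultimately show ?L using R
      by (auto simp: list_all2_conv_all_nth) (metis code_nth_eq not_le)
  qed
  have "decidable_in Z (\<lambda>z. (\<lambda>z. P (pfst z) (pfst (psnd z)) (psnd (psnd z)))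
      (prod_encode (code_nth (f (psnd z)) (pfst z),
         prod_encode (code_nth (g (psnd z)) (pfst z), psnd z))))"
    by (intro decidable_in_comp[OF assms(3)] recursive_in_comp[OF assms(1)]
        recursive_in_comp[OF assms(2)] recursive_in_code_nth recursive_intros)
  then show ?thesis unfolding *
    by (intro recursive_intros recursive_in_code_drop recursive_in_comp[OF assms(1)]
         recursive_in_comp[OF assms(2)] assms(1,2)) simp
qed

lemmas code_intros = recursive_intros recursive_in_code_hd recursive_in_code_tl
  recursive_in_code_drop recursive_in_code_nth recursive_in_list_encode_Nil
  recursive_in_list_encode_Cons recursive_in_list_encode_list_decode
  decidable_in_mem decidable_in_list_all2 decidable_in_ex_mem

section \<open>Coded computations\<close>

text \<open>
  A computation is coded as a list of triples \<open>[e, c, v]\<close>, each of which claims that the index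
  \<open>e\<close> applied to the argument list with code \<open>c\<close> has the value \<open>v\<close>. The disjuncts below say
  that a claim follows, by one of the defining clauses of \<open>kleene\<close>, from the claims in \<open>D\<close>; an
  oracle query may be answered by 0 or by 1 here. The constituents of \<open>e\<close> and the missing
  component of a claim in \<open>D\<close> are given as list entries, so that all remaining quantifiers
  are bounded.
\<close>

definition derivation_step :: "nat list \<Rightarrow> nat \<Rightarrow> nat \<Rightarrow> nat \<Rightarrow> bool" where
  "derivation_step D e c v \<longleftrightarrow>
     e = list_encode [0] \<and> v = 0
   \<or> e = list_encode [1] \<and> c \<noteq> 0 \<and> v = Suc (code_hd c)
   \<or> e = list_encode [2, code_nth e 1] \<and> code_drop (code_nth e 1) c \<noteq> 0 \<and> v = code_nth c (code_nth e 1)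
   \<or> e = list_encode [3] \<and> c \<noteq> 0 \<and> v \<le> 1
   \<or> e = list_encode [4, code_nth e 1, code_nth e 2] \<and>
      (\<exists>t\<in>set D. t = list_encode [code_nth e 1, code_nth t 1, v] \<and>
        list_all2 (\<lambda>g y. list_encode [g, c, y] \<in> set D) (list_decode (code_nth e 2)) (list_decode (code_nth t 1)))
   \<or> e = list_encode [5, code_nth e 1, code_nth e 2] \<and> c \<noteq> 0 \<and> code_hd c = 0 \<and>
      list_encode [code_nth e 1, code_tl c, v] \<in> set D
   \<or> e = list_encode [5, code_nth e 1, code_nth e 2] \<and> 0 < code_hd c \<and> c \<noteq> 0 \<and>
      (\<exists>t\<in>set D. t = list_encode [e, list_encode ((code_hd c - 1) # list_decode (code_tl c)), code_nth t 2] \<and>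
        list_encode [code_nth e 2,
          list_encode ((code_hd c - 1) # code_nth t 2 # list_decode (code_tl c)), v] \<in> set D)
   \<or> e = list_encode [6, code_nth e 1] \<and>
      list_encode [code_nth e 1, list_encode (v # list_decode c), 0] \<in> set D \<and>
      (\<forall>m<v. \<exists>t\<in>set D. 0 < code_nth t 2 \<and>
        t = list_encode [code_nth e 1, list_encode (m # list_decode c), code_nth t 2])"

text \<open>
  Every claim follows from those further to the right.
\<close>

primrec derivation :: "nat list \<Rightarrow> bool" where
  "derivation [] \<longleftrightarrow> True"
| "derivation (t # D) \<longleftrightarrow>
    derivation_step D (code_nth t 0) (code_nth t 1) (code_nth t 2) \<and> derivation D"

text \<open>
  The answers to the oracle queries in \<open>D\<close> are those of the oracle \<open>Z\<close>. This is the only part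
  of the correctness of a computation that depends on the oracle.
\<close>

definition queries_correct :: "nat set \<Rightarrow> nat list \<Rightarrow> bool" where
  "queries_correct Z D \<longleftrightarrow> (\<forall>t\<in>set D. code_nth t 0 = list_encode [3] \<longrightarrow>
    code_nth t 2 = (if code_hd (code_nth t 1) \<in> Z then 1 else 0))"

lemma derivation_step_sound:
  assumes step: "derivation_step D e (list_encode xs) v"
    and sound: "\<And>f ys w. list_encode [f, list_encode ys, w] \<in> set D \<Longrightarrow> kleene Z f ys w"
    and query: "e = list_encode [3] \<Longrightarrow> v = (if hd xs \<in> Z then 1 else 0)"
  shows "kleene Z e xs v"
  using step unfolding derivation_step_def
proof (elim disjE conjE bexE)
  assume "e = list_encode [0]" "v = 0"
  then show ?thesis by (simp only: kleene.zero)
next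
  assume "e = list_encode [1]" "list_encode xs \<noteq> 0" "v = Suc (code_hd (list_encode xs))"
  then show ?thesis using kleene.succ by (cases xs) auto
next
  assume "e = list_encode [2, code_nth e 1]" "code_drop (code_nth e 1) (list_encode xs) \<noteq> 0"
    "v = code_nth (list_encode xs) (code_nth e 1)"
  then show ?thesis using kleene.proj[of "code_nth e 1" xs] by simp
next
  assume "e = list_encode [3]" "list_encode xs \<noteq> 0"
  then show ?thesis using query kleene.query by (cases xs) auto
next
  fix t assume e: "e = list_encode [4, code_nth e 1, code_nth e 2]"
    and t: "t \<in> set D" "t = list_encode [code_nth e 1, code_nth t 1, v]"
    and all: "list_all2 (\<lambda>g y. list_encode [g, list_encode xs, y] \<in> set D)
      (list_decode (code_nth e 2)) (list_decode (code_nth t 1))"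
  have "kleene Z (list_encode [4, code_nth e 1, list_encode (list_decode (code_nth e 2))]) xs v"
  proof (rule kleene.comp)
    show "list_all2 (\<lambda>g y. kleene Z g xs y) (list_decode (code_nth e 2)) (list_decode (code_nth t 1))"
      using all by (rule list_all2_mono) (rule sound)
    have "list_encode [code_nth e 1, code_nth t 1, v] \<in> set D" using t by argo
    then show "kleene Z (code_nth e 1) (list_decode (code_nth t 1)) v" by (intro sound) simp
  qed
  with e show ?thesis by simp
next
  assume e: "e = list_encode [5, code_nth e 1, code_nth e 2]"
    and xs: "list_encode xs \<noteq> 0" "code_hd (list_encode xs) = 0"
    and D: "list_encode [code_nth e 1, code_tl (list_encode xs), v] \<in> set D"
  obtain ys where "xs = 0 # ys" using xs by (cases xs) auto
  moreover from this have "kleene Z (code_nth e 1) ys v" using D by (intro sound) simp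
  ultimately have "kleene Z (list_encode [5, code_nth e 1, code_nth e 2]) xs v"
    by (simp only: kleene.prec_0)
  with e show ?thesis by simp
next
  fix t assume e: "e = list_encode [5, code_nth e 1, code_nth e 2]"
    and xs: "list_encode xs \<noteq> 0" "0 < code_hd (list_encode xs)"
    and t: "t \<in> set D" "t = list_encode [e, list_encode ((code_hd (list_encode xs) - 1)
        # list_decode (code_tl (list_encode xs))), code_nth t 2]"
    and D: "list_encode [code_nth e 2, list_encode ((code_hd (list_encode xs) - 1)
        # code_nth t 2 # list_decode (code_tl (list_encode xs))), v] \<in> set D"
  obtain n ys where xs: "xs = Suc n # ys" using xs by (cases xs) (auto simp: gr0_conv_Suc)
  have "list_encode [e, list_encode (n # ys), code_nth t 2] \<in> set D"
    using t unfolding xs by simp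
  then have "kleene Z e (n # ys) (code_nth t 2)" by (rule sound)
  then have "kleene Z (list_encode [5, code_nth e 1, code_nth e 2]) (n # ys) (code_nth t 2)"
    using e by argo
  moreover have "kleene Z (code_nth e 2) (n # code_nth t 2 # ys) v"
    using D by (intro sound) (simp add: xs)
  ultimately have "kleene Z (list_encode [5, code_nth e 1, code_nth e 2]) xs v"
    unfolding xs by (rule kleene.prec_Suc)
  with e show ?thesis by simp
next
  assume e: "e = list_encode [6, code_nth e 1]"
    and 0: "list_encode [code_nth e 1, list_encode (v # list_decode (list_encode xs)), 0] \<in> set D"
    and pos: "\<forall>m<v. \<exists>t\<in>set D. 0 < code_nth t 2 \<and>
        t = list_encode [code_nth e 1, list_encode (m # list_decode (list_encode xs)), code_nth t 2]"
  have "kleene Z (list_encode [6, code_nth e 1]) xs v"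
  proof (rule kleene.mu)
    show "kleene Z (code_nth e 1) (v # xs) 0" using 0 by (intro sound) simp
    show "\<exists>w>0. kleene Z (code_nth e 1) (m # xs) w" if "m < v" for m
    proof -
      obtain t where "t \<in> set D" "0 < code_nth t 2"
          "t = list_encode [code_nth e 1, list_encode (m # xs), code_nth t 2]"
        using pos \<open>m < v\<close> by auto
      then show ?thesis by (metis sound)
    qed
  qed
  with e show ?thesis by simp
qed

lemma derivation_sound:
  "derivation D \<Longrightarrow> queries_correct Z D \<Longrightarrow> list_encode [e, list_encode xs, v] \<in> set D \<Longrightarrow> kleene Z e xs v"
proof (induction D arbitrary: e xs v)
  case (Cons t D)
  have IH: "kleene Z f ys w" if "list_encode [f, list_encode ys, w] \<in> set D" for f ys w
    using Cons that by (auto simp: queries_correct_def)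
  show ?case
  proof (cases "list_encode [e, list_encode xs, v] \<in> set D")
    case False
    then have t: "t = list_encode [e, list_encode xs, v]" using Cons.prems by simp
    have step: "derivation_step D e (list_encode xs) v" using Cons.prems(1) by (simp add: t)
    show ?thesis
    proof (rule derivation_step_sound[OF step IH])
      assume "e = list_encode [3]"
      moreover from this step have "xs \<noteq> []"
        by (auto simp: derivation_step_def list_encode_eq)
      ultimately show "v = (if hd xs \<in> Z then 1 else 0)"
        using Cons.prems(2) by (cases xs) (auto simp: t queries_correct_def)
    qed
  qed (rule IH)
qed simp

lemma bex_subset_forward: "\<exists>t\<in>A. P t \<Longrightarrow> A \<subseteq> B \<Longrightarrow> (\<And>t. P t \<Longrightarrow> Q t) \<Longrightarrow> \<exists>t\<in>B. Q t"
  by blast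

lemma derivation_step_mono:
  assumes "derivation_step D e c v" "set D \<subseteq> set D'" shows "derivation_step D' e c v"
  using assms(1) unfolding derivation_step_def
  by (elim disj_forward conj_forward all_forward imp_forward bex_subset_forward[OF _ assms(2)]
      list_all2_mono) (assumption | erule subsetD[OF assms(2)])+

lemma derivation_append: "derivation D \<Longrightarrow> derivation D' \<Longrightarrow> derivation (D @ D')"
  by (induction D) (auto intro: derivation_step_mono)

text \<open>
  The claim \<open>t\<close> occurs in some correct computation with oracle \<open>Z\<close>.
\<close>

definition derivable :: "nat set \<Rightarrow> nat \<Rightarrow> bool" where
  "derivable Z t \<longleftrightarrow> (\<exists>D. derivation D \<and> queries_correct Z D \<and> t \<in> set D)"

lemma derivable_hd: "\<exists>D. derivation (t # D) \<and> queries_correct Z (t # D) \<Longrightarrow> derivable Z t"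
  unfolding derivable_def by (meson list.set_intros(1))

lemma derivable_list:
  "\<forall>t\<in>set ts. derivable Z t \<Longrightarrow> \<exists>D. derivation D \<and> queries_correct Z D \<and> set ts \<subseteq> set D"
proof (induction ts)
  case Nil
  show ?case by (rule exI[of _ "[]"]) (simp add: queries_correct_def)
next
  case (Cons t ts)
  then obtain D D' where "derivation D" "queries_correct Z D" "set ts \<subseteq> set D"
    "derivation D'" "queries_correct Z D'" "t \<in> set D'" unfolding derivable_def by auto
  then show ?case
    by (intro exI[of _ "D @ D'"]) (auto simp: derivation_append queries_correct_def)
qed

lemma derivable_step:
  assumes "\<forall>t\<in>set ts. derivable Z t" "derivation_step ts e c v"
    and "e = list_encode [3] \<Longrightarrow> v = (if code_hd c \<in> Z then 1 else 0)"
  shows "\<exists>D. derivation (list_encode [e, c, v] # D) \<and> queries_correct Z (list_encode [e, c, v] # D)"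
proof -
  obtain D where "derivation D" "queries_correct Z D" "set ts \<subseteq> set D"
    using derivable_list[OF assms(1)] by blast
  with assms(2,3) show ?thesis
    by (intro exI[of _ D]) (auto simp: queries_correct_def intro: derivation_step_mono)
qed

lemma derivation_complete:
  "kleene Z e xs v \<Longrightarrow> \<exists>D. derivation (list_encode [e, list_encode xs, v] # D) \<and>
    queries_correct Z (list_encode [e, list_encode xs, v] # D)"
proof (induction rule: kleene.induct)
  case (zero xs)
  show ?case
    by (rule derivable_step[where ts = "[]"]) (auto simp: derivation_step_def list_encode_eq)
next
  case (succ x xs)
  show ?case
    by (rule derivable_step[where ts = "[]"]) (auto simp: derivation_step_def list_encode_eq)
next
  case (proj i xs)
  then show ?case
    by (intro derivable_step[where ts = "[]"]) (auto simp: derivation_step_def list_encode_eq)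
next
  case (query x xs)
  show ?case
    by (rule derivable_step[where ts = "[]"]) (auto simp: derivation_step_def list_encode_eq)
next
  case (comp xs gs ys f v)
  have D: "derivable Z (list_encode [f, list_encode ys, v])"
    using comp.IH by (blast intro: derivable_hd)
  have "list_all2 (\<lambda>g y. derivable Z (list_encode [g, list_encode xs, y])) gs ys"
    using comp.IH(1) by (rule list_all2_mono) (blast intro: derivable_hd)
  then have gs: "length gs = length ys"
      "\<And>g y. (g, y) \<in> set (zip gs ys) \<Longrightarrow> derivable Z (list_encode [g, list_encode xs, y])"
    by (auto simp: list_all2_iff)
  \<comment> \<open>The claims to be used: the value of the outer function and those of all inner functions.\<close>
  let ?ts = "list_encode [f, list_encode ys, v] # map (\<lambda>(g, y). list_encode [g, list_encode xs, y]) (zip gs ys)"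
  show ?case
  proof (rule derivable_step[where ts = ?ts])
    have "list_all2 (\<lambda>g y. list_encode [g, list_encode xs, y] \<in> set ?ts) gs ys"
      using gs(1) by (force simp: list_all2_iff)
    then show "derivation_step ?ts (list_encode [4, f, list_encode gs]) (list_encode xs) v"
      unfolding derivation_step_def
      by (intro disjI2[OF disjI2[OF disjI2[OF disjI2[OF disjI1]]]] conjI bexI[of _ "list_encode [f, list_encode ys, v]"])
        simp_all
  qed (use D gs(2) in \<open>auto simp: list_encode_eq\<close>)
next
  case (prec_0 f xs v g)
  then have D: "derivable Z (list_encode [f, list_encode xs, v])"
    by (blast intro: derivable_hd)
  show ?case
    by (rule derivable_step[where ts = "[list_encode [f, list_encode xs, v]]"])
      (auto simp: derivation_step_def list_encode_eq D)
next
  case (prec_Suc f g n xs r v)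
  have D: "derivable Z (list_encode [list_encode [5, f, g], list_encode (n # xs), r])"
    "derivable Z (list_encode [g, list_encode (n # r # xs), v])"
    using prec_Suc.IH by (blast intro: derivable_hd)+
  show ?case
    by (rule derivable_step[where ts = "[list_encode [list_encode [5, f, g], list_encode (n # xs), r],
        list_encode [g, list_encode (n # r # xs), v]]"])
      (auto simp: derivation_step_def list_encode_eq D)
next
  case (mu f n xs)
  have D: "derivable Z (list_encode [f, list_encode (n # xs), 0])"
    using mu.IH(1) by (blast intro: derivable_hd)
  have "\<exists>v>0. derivable Z (list_encode [f, list_encode (m # xs), v])" if "m < n" for m
    using mu.IH(2)[OF that] by (blast intro: derivable_hd)
  then obtain w where w: "\<And>m. m < n \<Longrightarrow> 0 < w m \<and> derivable Z (list_encode [f, list_encode (m # xs), w m])"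
    by metis
  show ?case
    by (rule derivable_step[where ts = "list_encode [f, list_encode (n # xs), 0]
        # map (\<lambda>m. list_encode [f, list_encode (m # xs), w m]) [0..<n]"])
      (auto simp: derivation_step_def list_encode_eq D w)
qed

text \<open>
  The normal form theorem: convergence means that there is a correct computation, which is a finite
  object.
\<close>

lemma kleene_iff_derivation:
  "kleene Z e xs v \<longleftrightarrow> (\<exists>D. derivation (list_encode [e, list_encode xs, v] # D) \<and>
    queries_correct Z (list_encode [e, list_encode xs, v] # D))"
  using derivation_complete derivation_sound[OF _ _ list.set_intros(1)] by blast

text \<open>
  \<open>d\<close> codes a computation of the index \<open>e\<close> on the single argument \<open>x\<close>, up to the correctness
  of its oracle answers; \<open>result d\<close> is the value that it claims.
\<close>

definition run :: "nat \<Rightarrow> nat \<Rightarrow> nat \<Rightarrow> bool" where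
  "run e x d \<longleftrightarrow> derivation (list_decode d) \<and> d \<noteq> 0 \<and>
    code_hd d = list_encode [e, list_encode [x], code_nth (code_hd d) 2]"

definition result :: "nat \<Rightarrow> nat" where "result d = code_nth (code_hd d) 2"

lemma kleene_iff_run:
  "kleene Z e [x] v \<longleftrightarrow> (\<exists>d. run e x d \<and> queries_correct Z (list_decode d) \<and> result d = v)"
proof
  assume "kleene Z e [x] v"
  then obtain D where "derivation (list_encode [e, list_encode [x], v] # D)"
    "queries_correct Z (list_encode [e, list_encode [x], v] # D)"
    unfolding kleene_iff_derivation by blast
  then show "\<exists>d. run e x d \<and> queries_correct Z (list_decode d) \<and> result d = v"
    by (intro exI[of _ "list_encode (list_encode [e, list_encode [x], v] # D)"])
      (simp add: run_def result_def)
next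
  assume "\<exists>d. run e x d \<and> queries_correct Z (list_decode d) \<and> result d = v"
  then obtain d where d: "run e x d" "queries_correct Z (list_decode d)" "result d = v" by blast
  then have "list_encode (list_decode d) \<noteq> 0" by (simp add: run_def del: list_encode_eq_0_iff)
  then obtain t D where D: "list_decode d = t # D" by (cases "list_decode d") auto
  have "code_hd d = t"
    using code_hd_list_encode[of t D] unfolding D[symmetric] by simp
  then have "t = list_encode [e, list_encode [x], v]" using d by (simp add: run_def result_def)
  then show "kleene Z e [x] v"
    using d(1,2) unfolding run_def D kleene_iff_derivation by blast
qed

lemma decidable_in_derivation_step:
  assumes "recursive_in Z D" "recursive_in Z e" "recursive_in Z c" "recursive_in Z v"
  shows "decidable_in Z (\<lambda>x. derivation_step (list_decode (D x)) (e x) (c x) (v x))"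
  unfolding derivation_step_def
  by (intro code_intros assms assms[THEN recursive_in_comp])

lemma derivation_iff_nth:
  "derivation D \<longleftrightarrow> (\<forall>i<length D. derivation_step (drop (Suc i) D)
    (code_nth (D ! i) 0) (code_nth (D ! i) 1) (code_nth (D ! i) 2))"
  by (induction D) (auto simp: less_Suc_eq_0_disj)

lemma derivation_list_decode_iff:
  "derivation (list_decode c) \<longleftrightarrow> (\<forall>i<c. code_drop i c \<noteq> 0 \<longrightarrow>
     derivation_step (list_decode (code_drop (Suc i) c))
      (code_nth (code_nth c i) 0) (code_nth (code_nth c i) 1) (code_nth (code_nth c i) 2))"
proof -
  have "list_decode (code_drop i c) = drop i (list_decode c)" for i
    using code_drop_list_encode[of i "list_decode c"] by simp
  then show ?thesis
    using length_list_decode_le[of c] unfolding derivation_iff_nth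
    by (auto simp: not_le code_nth_eq)
qed

lemma decidable_in_run:
  assumes "recursive_in Z e" "recursive_in Z x" "recursive_in Z d"
  shows "decidable_in Z (\<lambda>n. run (e n) (x n) (d n))"
  unfolding run_def derivation_list_decode_iff
  by (intro code_intros decidable_in_derivation_step assms assms[THEN recursive_in_comp])

text \<open>
  Kleene's T-predicate, for computations with the empty oracle.
\<close>

definition halts_in :: "nat \<Rightarrow> nat \<Rightarrow> nat \<Rightarrow> bool" where
  "halts_in e x d \<longleftrightarrow> run e x d \<and> queries_correct {} (list_decode d)"

lemma kleene_iff_halts_in: "kleene {} e [x] v \<longleftrightarrow> (\<exists>d. halts_in e x d \<and> result d = v)"
  unfolding kleene_iff_run halts_in_def by simp

lemma decidable_in_halts_in:
  assumes "recursive_in Z e" "recursive_in Z x" "recursive_in Z d"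
  shows "decidable_in Z (\<lambda>n. halts_in (e n) (x n) (d n))"
proof -
  have "queries_correct {} D \<longleftrightarrow> \<not> (\<exists>t\<in>set D. code_nth t 0 = list_encode [3] \<and> code_nth t 2 \<noteq> 0)" for D
    by (auto simp: queries_correct_def)
  then show ?thesis unfolding halts_in_def
    by (simp only:) (intro code_intros decidable_in_run assms assms[THEN recursive_in_comp])
qed

lemma recursive_in_result: "recursive_in Z f \<Longrightarrow> recursive_in Z (\<lambda>x. result (f x))"
  unfolding result_def by (intro code_intros)

section \<open>Passing between unary functions and functions of tuples\<close>

text \<open>
  Substitution of recursive functions into a \<open>k\<close>-ary computable function, for any \<open>k\<close>.
\<close>

lemma recursive_in_map:
  assumes "computable_in Z k F" "\<And>i. i < k \<Longrightarrow> recursive_in Z (f i)"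
  shows "recursive_in Z (\<lambda>x. F (map (\<lambda>i. f i x) [0..<k]))"
proof -
  let ?gs = "map (\<lambda>i xs. f i (xs ! 0)) [0..<k]"
  have "computable_in Z 1 (\<lambda>xs. F (map (\<lambda>g. g xs) ?gs))"
    by (rule computable_in_comp) (use assms in \<open>auto simp: recursive_in_iff\<close>)
  then show ?thesis by (simp add: recursive_in_iff comp_def)
qed

lemma computable_in_list_encode_map:
  "\<forall>g\<in>set gs. computable_in Z k g \<Longrightarrow> computable_in Z k (\<lambda>xs. list_encode (map (\<lambda>g. g xs) gs))"
  by (induction gs)
    (auto simp: list_encode.simps intro!: computable_in_const computable_in_Suc computable_in_prod_encode)

lemma computable_in_list_encode: "computable_in Z k list_encode"
proof (rule computable_in_cong)
  show "computable_in Z k (\<lambda>xs. list_encode (map (\<lambda>g. g xs) (map (\<lambda>i xs. xs ! i) [0..<k])))"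
    by (rule computable_in_list_encode_map) (auto intro: computable_in_nth)
next
  fix xs :: "nat list" assume "length xs = k"
  then show "list_encode (map (\<lambda>g. g xs) (map (\<lambda>i xs. xs ! i) [0..<k])) = list_encode xs"
    using map_nth[of xs] by (simp add: comp_def)
qed

lemma computable_in_of_recursive_in:
  assumes "recursive_in Z f" "computable_in Z k g" shows "computable_in Z k (\<lambda>xs. f (g xs))"
  using computable_in_comp1 assms unfolding recursive_in_iff by blast

section \<open>Parametrization, universality and search\<close>

lemma kleene_comp1:
  "kleene Z (list_encode [4, f, list_encode [g]]) xs v \<longleftrightarrow> (\<exists>y. kleene Z g xs y \<and> kleene Z f [y] v)"
  unfolding kleene_iff by (auto simp: list_all2_Cons1)

lemma kleene_comp2:
  "kleene Z (list_encode [4, f, list_encode [g, h]]) xs v \<longleftrightarrow>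
    (\<exists>y z. kleene Z g xs y \<and> kleene Z h xs z \<and> kleene Z f [y, z] v)"
  unfolding kleene_iff by (auto simp: list_all2_Cons1)

lemma kleene_comp3:
  "kleene Z (list_encode [4, f, list_encode [g, h, k]]) xs v \<longleftrightarrow>
    (\<exists>x y z. kleene Z g xs x \<and> kleene Z h xs y \<and> kleene Z k xs z \<and> kleene Z f [x, y, z] v)"
  (is "?L \<longleftrightarrow> ?R")
proof
  assume ?R
  then obtain x y z where "list_all2 (\<lambda>e v. kleene Z e xs v) [g, h, k] [x, y, z]" "kleene Z f [x, y, z] v"
    by auto
  then show ?L by (rule kleene.comp)
qed (auto simp: kleene_iff list_all2_Cons1)

text \<open>
  An index of the constant function with value \<open>p\<close>, computable from \<open>p\<close>.
\<close>

definition const_index :: "nat \<Rightarrow> nat" where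
  "const_index p = rec_nat (list_encode [0]) (\<lambda>_ r. list_encode [4, list_encode [1], list_encode [r]]) p"

lemma kleene_const_index: "kleene Z (const_index p) xs v \<longleftrightarrow> v = p"
proof (induction p arbitrary: v)
  case (Suc p)
  have "const_index (Suc p) = list_encode [4, list_encode [1], list_encode [const_index p]]"
    by (simp add: const_index_def)
  then show ?case by (simp only: kleene_comp1 Suc) (simp only: kleene_iff, simp)
qed (simp add: const_index_def kleene_iff)

text \<open>
  The parameter theorem for one argument and one parameter: \<open>smn e p\<close> is an index of
  \<open>\<lambda>y. \<phi>\<^sub>e(y, p)\<close>, for all oracles at once.
\<close>

definition smn :: "nat \<Rightarrow> nat \<Rightarrow> nat" where
  "smn e p = list_encode [4, e, list_encode [list_encode [2, 0], const_index p]]"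

lemma kleene_smn: "kleene Z (smn e p) [y] v \<longleftrightarrow> kleene Z e [y, p] v"
  unfolding smn_def kleene_comp2 kleene_const_index by (simp add: kleene_iff)

lemma recursive_in_smn:
  assumes "recursive_in Z e" "recursive_in Z p" shows "recursive_in Z (\<lambda>x. smn (e x) (p x))"
proof -
  have "recursive_in Z (\<lambda>x. const_index (p x))"
    unfolding const_index_def
    by (rule recursive_in_rec_nat[OF recursive_in_const _ assms(2)]) (intro code_intros)
  then show ?thesis unfolding smn_def by (intro code_intros assms)
qed

lemma recursive_in_imp_ternary_index:
  assumes "recursive_in Z (\<lambda>z. f (pfst z) (pfst (psnd z)) (psnd (psnd z)))"
  shows "\<exists>e. \<forall>x y z. kleene Z e [x, y, z] (f x y z)"
proof -
  have "computable_in Z 3 (\<lambda>xs. (\<lambda>z. f (pfst z) (pfst (psnd z)) (psnd (psnd z)))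
      (prod_encode (xs ! 0, prod_encode (xs ! 1, xs ! 2))))"
    by (rule computable_in_of_recursive_in[OF assms])
      (intro computable_in_prod_encode computable_in_nth; simp)
  then obtain e where e: "\<And>xs. length xs = 3 \<Longrightarrow> kleene Z e xs (f (xs ! 0) (xs ! 1) (xs ! 2))"
    unfolding computable_in_def by auto
  have "kleene Z e [x, y, z] (f x y z)" for x y z using e[of "[x, y, z]"] by simp
  then show ?thesis by blast
qed

lemma ex_search_index:
  assumes "decidable_in Z (\<lambda>z. P (pfst z) (pfst (psnd z)) (psnd (psnd z)))"
  shows "\<exists>e. \<forall>y n t. kleene Z e [y, n] t \<longleftrightarrow> P t y n \<and> (\<forall>m<t. \<not> P m y n)"
proof -
  have "recursive_in Z (\<lambda>z. if P (pfst z) (pfst (psnd z)) (psnd (psnd z)) then 0 else 1)"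
    by (intro recursive_intros assms)
  from recursive_in_imp_ternary_index[of Z "\<lambda>t y n. if P t y n then 0 else 1", OF this]
  obtain e where e: "\<And>t y n. kleene Z e [t, y, n] (if P t y n then 0 else 1)" by blast
  have "kleene Z (list_encode [6, e]) [y, n] t \<longleftrightarrow> P t y n \<and> (\<forall>m<t. \<not> P m y n)" for t y n
    by (subst kleene_mu_iff[OF e]) auto
  then show ?thesis by blast
qed

lemma ex_universal_index: "\<exists>u. \<forall>e x v. kleene {} u [e, x] v \<longleftrightarrow> kleene {} e [x] v"
proof -
  have "decidable_in {} (\<lambda>z. halts_in (pfst (psnd z)) (psnd (psnd z)) (pfst z))"
    by (intro decidable_in_halts_in recursive_intros)
  from ex_search_index[of "{}" "\<lambda>d e x. halts_in e x d", OF this]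
  obtain s where s: "\<And>e x d. kleene {} s [e, x] d \<longleftrightarrow> halts_in e x d \<and> (\<forall>d'<d. \<not> halts_in e x d')"
    by auto
  obtain r where "\<And>d. kleene {} r [d] (result d)"
    using recursive_in_result[OF recursive_in_id] unfolding recursive_in_def by blast
  then have r: "kleene {} r [d] v \<longleftrightarrow> v = result d" for d v
    using kleene_deterministic by blast
  have "kleene {} (list_encode [4, r, list_encode [s]]) [e, x] v \<longleftrightarrow> kleene {} e [x] v" for e x v
  proof
    assume "kleene {} e [x] v"
    then obtain d where d: "halts_in e x d" "result d = v" unfolding kleene_iff_halts_in by blast
    obtain d0 where d0: "halts_in e x d0" "\<forall>d'<d0. \<not> halts_in e x d'"
      using d(1) exists_least_iff[of "halts_in e x"] by blast
    then have "kleene {} e [x] (result d0)" unfolding kleene_iff_halts_in by auto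
    then have "v = result d0" using \<open>kleene {} e [x] v\<close> by (rule kleene_deterministic[rotated])
    with d0 show "kleene {} (list_encode [4, r, list_encode [s]]) [e, x] v"
      unfolding kleene_comp1 s r by auto
  next
    assume "kleene {} (list_encode [4, r, list_encode [s]]) [e, x] v"
    then obtain d where "halts_in e x d" "v = result d" unfolding kleene_comp1 s r by auto
    then show "kleene {} e [x] v" unfolding kleene_iff_halts_in by auto
  qed
  then show ?thesis by blast
qed

text \<open>
  A partial computable function can search for the least \<open>t\<close> with a decidable property, compute
  an index from the outcome, and behave at \<open>y\<close> like the function with this index.
\<close>

lemma ex_search_apply_index:
  assumes "decidable_in {} (\<lambda>z. P (pfst z) (psnd z))"
    and "recursive_in {} (\<lambda>z. f (pfst z) (pfst (psnd z)) (psnd (psnd z)))"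
  shows "\<exists>d. \<forall>y p v. kleene {} d [y, p] v \<longleftrightarrow>
    (\<exists>t. P t p \<and> (\<forall>m<t. \<not> P m p) \<and> kleene {} (f t y p) [y] v)"
proof -
  have "decidable_in {} (\<lambda>z. (\<lambda>z. P (pfst z) (psnd z)) (prod_encode (pfst z, psnd (psnd z))))"
    by (intro decidable_in_comp[OF assms(1)] recursive_intros)
  then have "decidable_in {} (\<lambda>z. P (pfst z) (psnd (psnd z)))" by simp
  from ex_search_index[of "{}" "\<lambda>t y p. P t p", OF this]
  obtain s where s: "\<And>y p t. kleene {} s [y, p] t \<longleftrightarrow> P t p \<and> (\<forall>m<t. \<not> P m p)" by auto
  obtain e where "\<And>t y p. kleene {} e [t, y, p] (f t y p)"
    using recursive_in_imp_ternary_index[of "{}" f, OF assms(2)] by blast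
  then have e: "kleene {} e [t, y, p] v \<longleftrightarrow> v = f t y p" for t y p v
    using kleene_deterministic by auto
  obtain u where u: "\<And>e x v. kleene {} u [e, x] v \<longleftrightarrow> kleene {} e [x] v"
    using ex_universal_index by blast
  define g where "g = list_encode [4, e, list_encode [s, list_encode [2, 0], list_encode [2, 1]]]"
  have g: "kleene {} g [y, p] w \<longleftrightarrow> (\<exists>t. P t p \<and> (\<forall>m<t. \<not> P m p) \<and> w = f t y p)" for y p w
    unfolding g_def kleene_comp3 s e kleene_iff(3) by auto
  have "kleene {} (list_encode [4, u, list_encode [g, list_encode [2, 0]]]) [y, p] v \<longleftrightarrow>
    (\<exists>t. P t p \<and> (\<forall>m<t. \<not> P m p) \<and> kleene {} (f t y p) [y] v)" for y p v
    unfolding kleene_comp2 g u kleene_iff(3) by auto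
  then show ?thesis by blast
qed

section \<open>The first two levels of the arithmetical hierarchy\<close>

text \<open>
  The predicates of level 1 and 2 of the arithmetical hierarchy, with the decidable matrix given as
  a predicate on numbers. As for \<open>oracle_set\<close> and \<open>sim\<close>, only \<open>l \<in> {1, 2}\<close> is meant.
\<close>

definition sigma :: "nat \<Rightarrow> (nat \<Rightarrow> bool) \<Rightarrow> bool" where
  "sigma l R \<longleftrightarrow> (if l = 1
    then \<exists>P. decidable_in {} (\<lambda>p. P (pfst p) (psnd p)) \<and> (\<forall>n. R n \<longleftrightarrow> (\<exists>y. P y n))
    else \<exists>P. decidable_in {} (\<lambda>p. P (pfst p) (pfst (psnd p)) (psnd (psnd p))) \<and>
      (\<forall>n. R n \<longleftrightarrow> (\<exists>y. \<forall>z. P z y n)))"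

lemma sigma1I:
  "decidable_in {} (\<lambda>p. P (pfst p) (psnd p)) \<Longrightarrow> (\<And>n. R n \<longleftrightarrow> (\<exists>y. P y n)) \<Longrightarrow> sigma 1 R"
  unfolding sigma_def by auto

lemma sigma_1_iff:
  "sigma 1 R \<longleftrightarrow> (\<exists>P. decidable_in {} (\<lambda>p. P (pfst p) (psnd p)) \<and> (\<forall>n. R n \<longleftrightarrow> (\<exists>y. P y n)))"
  unfolding sigma_def by (simp only: if_True refl)

lemma sigma2I:
  "decidable_in {} (\<lambda>p. P (pfst p) (pfst (psnd p)) (psnd (psnd p))) \<Longrightarrow>
    (\<And>n. R n \<longleftrightarrow> (\<exists>y. \<forall>z. P z y n)) \<Longrightarrow> sigma 2 R"
  unfolding sigma_def by auto

lemma sigma_2_iff: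
  "sigma 2 R \<longleftrightarrow> (\<exists>P. decidable_in {} (\<lambda>p. P (pfst p) (pfst (psnd p)) (psnd (psnd p))) \<and>
    (\<forall>n. R n \<longleftrightarrow> (\<exists>y. \<forall>z. P z y n)))"
  unfolding sigma_def by simp

lemma decidable_in_nth2:
  assumes "computable 2 (\<lambda>xs. if xs \<in> Q then 1 else 0)"
  shows "decidable_in {} (\<lambda>p. [pfst p, psnd p] \<in> Q)"
proof -
  have "recursive_in {} (\<lambda>p. if map (\<lambda>i. [pfst p, psnd p] ! i) [0..<2] \<in> Q then 1 else 0)"
    using assms unfolding computable_iff_computable_in
    by (rule recursive_in_map) (auto simp: less_2_cases_iff intro!: recursive_intros)
  then show ?thesis by (simp add: decidable_in_def upt_rec)
qed

lemma decidable_in_nth3: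
  assumes "computable 3 (\<lambda>xs. if xs \<in> Q then 1 else 0)"
  shows "decidable_in {} (\<lambda>p. [pfst p, pfst (psnd p), psnd (psnd p)] \<in> Q)"
proof -
  have "recursive_in {} (\<lambda>p. [pfst p, pfst (psnd p), psnd (psnd p)] ! i)" if "i < 3" for i
  proof -
    have "i = 0 \<or> i = 1 \<or> i = 2" using that by auto
    then show ?thesis by (elim disjE) (simp; intro recursive_intros)+
  qed
  then have "recursive_in {} (\<lambda>p. if map (\<lambda>i. [pfst p, pfst (psnd p), psnd (psnd p)] ! i) [0..<3] \<in> Q
      then 1 else 0)"
    using assms unfolding computable_iff_computable_in by (intro recursive_in_map) auto
  then show ?thesis by (simp add: decidable_in_def upt_rec)
qed

lemma Sigma0_1_iff: "Sigma0 1 A \<longleftrightarrow> sigma 1 (\<lambda>n. n \<in> A)"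
proof
  assume "Sigma0 1 A"
  then obtain Q where Q: "computable 2 (\<lambda>xs. if xs \<in> Q then 1 else 0)"
    "\<And>xs. length xs = 1 \<Longrightarrow> xs \<in> {[n] | n. n \<in> A} \<longleftrightarrow> (\<exists>y. y # xs \<notin> Q)"
    unfolding Sigma0_def numeral_2_eq_2 One_nat_def Sigma0_rel.simps by blast
  have "n \<in> A \<longleftrightarrow> (\<exists>y. [y, n] \<notin> Q)" for n using Q(2)[of "[n]"] by simp
  then show "sigma 1 (\<lambda>n. n \<in> A)"
    by (intro sigma1I[of "\<lambda>y n. [y, n] \<notin> Q"] decidable_in_not decidable_in_nth2[OF Q(1)]) auto
next
  assume "sigma 1 (\<lambda>n. n \<in> A)"
  then obtain P where P: "decidable_in {} (\<lambda>p. P (pfst p) (psnd p))" "\<And>n. n \<in> A \<longleftrightarrow> (\<exists>y. P y n)"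
    unfolding sigma_1_iff by blast
  define Q where "Q = {[y, n] | y n. \<not> P y n}"
  have "computable_in {} 2 (\<lambda>xs. (\<lambda>p. if \<not> P (pfst p) (psnd p) then 1 else 0) (prod_encode (xs ! 0, xs ! 1)))"
    by (rule computable_in_of_recursive_in)
      (use decidable_in_not[OF P(1)] in \<open>auto simp: decidable_in_def intro!: computable_in_prod_encode computable_in_nth\<close>)
  then have "computable 2 (\<lambda>xs. if xs \<in> Q then 1 else 0)"
    unfolding computable_iff_computable_in
    by (rule computable_in_cong) (auto simp: Q_def numeral_2_eq_2 length_Suc_conv)
  moreover have "xs \<in> {[n] | n. n \<in> A} \<longleftrightarrow> (\<exists>y. y # xs \<notin> Q)" if "length xs = 1" for xs
    using that by (auto simp: Q_def P(2) length_Suc_conv)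
  ultimately show "Sigma0 1 A"
    unfolding Sigma0_def numeral_2_eq_2 One_nat_def Sigma0_rel.simps by blast
qed

lemma Sigma0_2_iff: "Sigma0 2 A \<longleftrightarrow> sigma 2 (\<lambda>n. n \<in> A)"
proof
  assume "Sigma0 2 A"
  then obtain Q Q' where Q': "computable 3 (\<lambda>xs. if xs \<in> Q' then 1 else 0)"
    "\<And>xs. length xs = 2 \<Longrightarrow> xs \<in> Q \<longleftrightarrow> (\<exists>y. y # xs \<notin> Q')"
    and Q: "\<And>xs. length xs = 1 \<Longrightarrow> xs \<in> {[n] | n. n \<in> A} \<longleftrightarrow> (\<exists>y. y # xs \<notin> Q)"
    unfolding Sigma0_def numeral_2_eq_2 numeral_3_eq_3 One_nat_def Sigma0_rel.simps by blast
  have "n \<in> A \<longleftrightarrow> (\<exists>y. \<forall>z. [z, y, n] \<in> Q')" for n using Q[of "[n]"] Q'(2)[of "[_, n]"] by simp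
  then show "sigma 2 (\<lambda>n. n \<in> A)"
    by (intro sigma2I[of "\<lambda>z y n. [z, y, n] \<in> Q'"] decidable_in_nth3[OF Q'(1)]) auto
next
  assume "sigma 2 (\<lambda>n. n \<in> A)"
  then obtain P where P: "decidable_in {} (\<lambda>p. P (pfst p) (pfst (psnd p)) (psnd (psnd p)))"
    "\<And>n. n \<in> A \<longleftrightarrow> (\<exists>y. \<forall>z. P z y n)"
    unfolding sigma_2_iff by blast
  define Q' where "Q' = {[z, y, n] | z y n. P z y n}"
  define Q where "Q = {[y, n] | y n. \<exists>z. \<not> P z y n}"
  have "computable_in {} 3 (\<lambda>xs. (\<lambda>p. if P (pfst p) (pfst (psnd p)) (psnd (psnd p)) then 1 else 0)
      (prod_encode (xs ! 0, prod_encode (xs ! 1, xs ! 2))))"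
    by (rule computable_in_of_recursive_in)
      (use P(1) in \<open>auto simp: decidable_in_def intro!: computable_in_prod_encode computable_in_nth\<close>)
  then have "computable 3 (\<lambda>xs. if xs \<in> Q' then 1 else 0)"
    unfolding computable_iff_computable_in
    by (rule computable_in_cong) (auto simp: Q'_def numeral_3_eq_3 length_Suc_conv)
  moreover have "xs \<in> Q \<longleftrightarrow> (\<exists>y. y # xs \<notin> Q')" if "length xs = 2" for xs
    using that by (auto simp: Q_def Q'_def numeral_2_eq_2 length_Suc_conv)
  moreover have "xs \<in> {[n] | n. n \<in> A} \<longleftrightarrow> (\<exists>y. y # xs \<notin> Q)" if "length xs = 1" for xs
    using that by (auto simp: Q_def P(2) length_Suc_conv)
  ultimately show "Sigma0 2 A"
    unfolding Sigma0_def numeral_2_eq_2 numeral_3_eq_3 One_nat_def Sigma0_rel.simps by blast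
qed

lemma Sigma0_iff_sigma: "l \<in> {1, 2} \<Longrightarrow> Sigma0 l A \<longleftrightarrow> sigma l (\<lambda>n. n \<in> A)"
  using Sigma0_1_iff Sigma0_2_iff by auto

lemma sigma_comp:
  assumes "sigma l R" "recursive_in {} f" "l \<in> {1, 2}" shows "sigma l (\<lambda>n. R (f n))"
proof (cases "l = 1")
  case True
  then obtain P where P: "decidable_in {} (\<lambda>p. P (pfst p) (psnd p))" "\<And>n. R n \<longleftrightarrow> (\<exists>y. P y n)"
    using assms(1) unfolding True sigma_1_iff by blast
  have "decidable_in {} (\<lambda>p. (\<lambda>p. P (pfst p) (psnd p)) (prod_encode (pfst p, f (psnd p))))"
    by (intro decidable_in_comp[OF P(1)] recursive_intros recursive_in_comp[OF assms(2)])
  then show ?thesis unfolding \<open>l = 1\<close> by (intro sigma1I[of "\<lambda>y n. P y (f n)"]) (auto simp: P(2))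
next
  case False
  then have l: "l = 2" using assms(3) by simp
  then obtain P where P: "decidable_in {} (\<lambda>p. P (pfst p) (pfst (psnd p)) (psnd (psnd p)))"
      "\<And>n. R n \<longleftrightarrow> (\<exists>y. \<forall>z. P z y n)"
    using assms(1) unfolding l sigma_2_iff by blast
  have "decidable_in {} (\<lambda>p. (\<lambda>p. P (pfst p) (pfst (psnd p)) (psnd (psnd p)))
      (prod_encode (pfst p, prod_encode (pfst (psnd p), f (psnd (psnd p))))))"
    by (intro decidable_in_comp[OF P(1)] recursive_intros recursive_in_comp[OF assms(2)])
  then show ?thesis unfolding l by (intro sigma2I[of "\<lambda>z y n. P z y (f n)"]) (auto simp: P(2))
qed

text \<open>
  The existential quantifier over \<open>d\<close> is merged with the leading one of \<open>R\<close> by pairing.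
\<close>

lemma sigma_ex_conj:
  assumes "decidable_in {} (\<lambda>p. Q (pfst p) (psnd p))" "sigma l (\<lambda>p. R (pfst p) (psnd p))"
    "l \<in> {1, 2}"
  shows "sigma l (\<lambda>n. \<exists>d. Q d n \<and> R d n)"
proof (cases "l = 1")
  case True
  then obtain P where P: "decidable_in {} (\<lambda>p. P (pfst p) (psnd p))"
      "\<And>p. R (pfst p) (psnd p) \<longleftrightarrow> (\<exists>y. P y p)"
    using assms(2) unfolding True sigma_1_iff by blast
  have R: "R d n \<longleftrightarrow> (\<exists>y. P y (prod_encode (d, n)))" for d n
    using P(2)[of "prod_encode (d, n)"] by simp
  have "decidable_in {} (\<lambda>p. (\<lambda>p. Q (pfst p) (psnd p)) (prod_encode (pfst (pfst p), psnd p)) \<and>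
      (\<lambda>p. P (pfst p) (psnd p)) (prod_encode (psnd (pfst p), prod_encode (pfst (pfst p), psnd p))))"
    by (rule decidable_in_conj; intro decidable_in_comp[OF P(1)] decidable_in_comp[OF assms(1)] recursive_intros)
  then show ?thesis unfolding \<open>l = 1\<close>
    by (intro sigma1I[of "\<lambda>y n. Q (pfst y) n \<and> P (psnd y) (prod_encode (pfst y, n))"])
      (auto simp: R, metis pfst_prod_encode psnd_prod_encode)
next
  case False
  then have l: "l = 2" using assms(3) by simp
  then obtain P where P: "decidable_in {} (\<lambda>p. P (pfst p) (pfst (psnd p)) (psnd (psnd p)))"
      "\<And>p. R (pfst p) (psnd p) \<longleftrightarrow> (\<exists>y. \<forall>z. P z y p)"
    using assms(2) unfolding l sigma_2_iff by blast
  have R: "R d n \<longleftrightarrow> (\<exists>y. \<forall>z. P z y (prod_encode (d, n)))" for d n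
    using P(2)[of "prod_encode (d, n)"] by simp
  have "decidable_in {} (\<lambda>p. (\<lambda>p. Q (pfst p) (psnd p)) (prod_encode (pfst (pfst (psnd p)), psnd (psnd p))) \<and>
      (\<lambda>p. P (pfst p) (pfst (psnd p)) (psnd (psnd p))) (prod_encode (pfst p,
        prod_encode (psnd (pfst (psnd p)), prod_encode (pfst (pfst (psnd p)), psnd (psnd p))))))"
    by (rule decidable_in_conj; intro decidable_in_comp[OF P(1)] decidable_in_comp[OF assms(1)] recursive_intros)
  then show ?thesis unfolding l
    by (intro sigma2I[of "\<lambda>z y n. Q (pfst y) n \<and> P z (psnd y) (prod_encode (pfst y, n))"])
      (auto simp: R, metis pfst_prod_encode psnd_prod_encode)
qed

section \<open>Domains of partial computable functions in the hierarchy\<close>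

lemma W_iff: "x \<in> W Z e \<longleftrightarrow> (\<exists>v. kleene Z e [x] v)"
  by (auto simp: W_def phi_def)

lemma W_iff_run: "x \<in> W Z e \<longleftrightarrow> (\<exists>d. run e x d \<and> queries_correct Z (list_decode d))"
  unfolding W_iff kleene_iff_run by blast

lemma W_iff_halts_in: "x \<in> W {} e \<longleftrightarrow> (\<exists>d. halts_in e x d)"
  unfolding W_iff kleene_iff_halts_in by blast

lemma oracle_set_simps: "oracle_set 1 = {}" "oracle_set 2 = {n. n \<in> W {} n}"
  by (simp_all add: oracle_set_def)

lemma sigma_W_1: "sigma 1 (\<lambda>p. psnd p \<in> W {} (pfst p))"
proof (rule sigma1I)
  show "decidable_in {} (\<lambda>p. (\<lambda>d p. halts_in (pfst p) (psnd p) d) (pfst p) (psnd p))"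
    by (intro decidable_in_halts_in recursive_intros)
qed (simp add: W_iff_halts_in)

text \<open>
  A decidable approximation to the correctness of the answers in \<open>D\<close> for the halting problem as
  oracle: the positive answers are confirmed by computations below \<open>s\<close>, and the negative ones
  are not refuted by the computation \<open>t\<close>.
\<close>

definition queries_correct_upto :: "nat \<Rightarrow> nat \<Rightarrow> nat list \<Rightarrow> bool" where
  "queries_correct_upto s t D \<longleftrightarrow> (\<forall>q\<in>set D. code_nth q 0 = list_encode [3] \<longrightarrow>
    (let x = code_hd (code_nth q 1) in
      code_nth q 2 = 1 \<and> (\<exists>d<s. halts_in x x d) \<or> code_nth q 2 = 0 \<and> \<not> halts_in x x t))"

text \<open>
  Only finitely many positive answers occur in \<open>D\<close>, so one bound \<open>s\<close> serves all of them.
\<close>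

lemma queries_correct_halting_iff:
  "queries_correct {n. n \<in> W {} n} D \<longleftrightarrow> (\<exists>s. \<forall>t. queries_correct_upto s t D)"
proof
  assume D: "queries_correct {n. n \<in> W {} n} D"
  define time where "time q = (SOME d. halts_in (code_hd (code_nth q 1)) (code_hd (code_nth q 1)) d)" for q
  have "queries_correct_upto (Suc (Max (time ` set D))) t D" for t
    unfolding queries_correct_upto_def Let_def
  proof (intro ballI impI)
    fix q let ?x = "code_hd (code_nth q 1)"
    assume q: "q \<in> set D" "code_nth q 0 = list_encode [3]"
    show "code_nth q 2 = 1 \<and> (\<exists>d<Suc (Max (time ` set D)). halts_in ?x ?x d) \<or>
        code_nth q 2 = 0 \<and> \<not> halts_in ?x ?x t"
    proof (cases "?x \<in> W {} ?x")
      case True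
      then have "halts_in ?x ?x (time q)"
        unfolding time_def W_iff_halts_in by (rule someI_ex)
      moreover have "time q < Suc (Max (time ` set D))"
        using q(1) by (simp add: less_Suc_eq_le)
      ultimately show ?thesis using D q True unfolding queries_correct_def by auto
    next
      case False
      then show ?thesis using D q unfolding queries_correct_def W_iff_halts_in by auto
    qed
  qed
  then show "\<exists>s. \<forall>t. queries_correct_upto s t D" by blast
next
  assume "\<exists>s. \<forall>t. queries_correct_upto s t D"
  then obtain s where s: "\<And>t. queries_correct_upto s t D" by blast
  show "queries_correct {n. n \<in> W {} n} D"
    unfolding queries_correct_def
  proof (intro ballI impI)
    fix q let ?x = "code_hd (code_nth q 1)"
    assume q: "q \<in> set D" "code_nth q 0 = list_encode [3]"
    have *: "code_nth q 2 = 1 \<and> (\<exists>d<s. halts_in ?x ?x d) \<or> code_nth q 2 = 0 \<and> \<not> halts_in ?x ?x t" for t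
      using s[of t] q unfolding queries_correct_upto_def Let_def by blast
    show "code_nth q 2 = (if ?x \<in> {n. n \<in> W {} n} then 1 else 0)"
    proof (cases "?x \<in> W {} ?x")
      case True
      then obtain d where "halts_in ?x ?x d" unfolding W_iff_halts_in by blast
      then show ?thesis using *[of d] True by auto
    next
      case False
      then have "\<not> (\<exists>d<s. halts_in ?x ?x d)" unfolding W_iff_halts_in by blast
      then show ?thesis using *[of 0] False by auto
    qed
  qed
qed

text \<open>
  One half of Post's theorem at level 2: the sets computably enumerable in the halting problem are
  uniformly \<open>\<Sigma>\<^sup>0\<^sub>2\<close>.
\<close>

lemma sigma_W_2: "sigma 2 (\<lambda>p. psnd p \<in> W {n. n \<in> W {} n} (pfst p))"
proof (rule sigma2I)
  let ?P = "\<lambda>t y p. run (pfst p) (psnd p) (pfst y) \<and> \<not> (\<exists>q\<in>set (list_decode (pfst y)).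
    code_nth q 0 = list_encode [3] \<and>
    \<not> (code_nth q 2 = 1 \<and> (\<exists>d<psnd y. halts_in (code_hd (code_nth q 1)) (code_hd (code_nth q 1)) d) \<or>
      code_nth q 2 = 0 \<and> \<not> halts_in (code_hd (code_nth q 1)) (code_hd (code_nth q 1)) t))"
  show "decidable_in {} (\<lambda>p. ?P (pfst p) (pfst (psnd p)) (psnd (psnd p)))"
    by (intro decidable_in_run decidable_in_halts_in code_intros)
  have P: "?P t y p \<longleftrightarrow> run (pfst p) (psnd p) (pfst y) \<and>
      queries_correct_upto (psnd y) t (list_decode (pfst y))" for t y p
    unfolding queries_correct_upto_def Let_def by blast
  fix p
  have "psnd p \<in> W {n. n \<in> W {} n} (pfst p) \<longleftrightarrow>
    (\<exists>d. run (pfst p) (psnd p) d \<and> (\<exists>s. \<forall>t. queries_correct_upto s t (list_decode d)))"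
    unfolding W_iff_run[of "psnd p"] queries_correct_halting_iff ..
  also have "\<dots> \<longleftrightarrow> (\<exists>y. \<forall>t. run (pfst p) (psnd p) (pfst y) \<and>
      queries_correct_upto (psnd y) t (list_decode (pfst y)))"
    by (metis pfst_prod_encode psnd_prod_encode)
  finally show "psnd p \<in> W {n. n \<in> W {} n} (pfst p) \<longleftrightarrow> (\<exists>y. \<forall>t. ?P t y p)"
    unfolding P .
qed

lemma sigma_W: "l \<in> {1, 2} \<Longrightarrow> sigma l (\<lambda>p. psnd p \<in> W (oracle_set l) (pfst p))"
  using sigma_W_1 sigma_W_2 oracle_set_simps by auto

lemma ex_index_of_sigma_1:
  assumes "sigma 1 R" shows "\<exists>e. \<forall>y n. (\<exists>v. kleene {} e [y, n] v) \<longleftrightarrow> R n"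
proof -
  obtain P where P: "decidable_in {} (\<lambda>p. P (pfst p) (psnd p))" "\<And>n. R n \<longleftrightarrow> (\<exists>t. P t n)"
    using assms unfolding sigma_1_iff by blast
  have "decidable_in {} (\<lambda>z. (\<lambda>p. P (pfst p) (psnd p)) (prod_encode (pfst z, psnd (psnd z))))"
    by (intro decidable_in_comp[OF P(1)] recursive_intros)
  then have "decidable_in {} (\<lambda>z. P (pfst z) (psnd (psnd z)))" by simp
  from ex_search_index[of "{}" "\<lambda>t y n. P t n", OF this]
  obtain e where "\<And>y n t. kleene {} e [y, n] t \<longleftrightarrow> P t n \<and> (\<forall>m<t. \<not> P m n)" by auto
  then have "(\<exists>v. kleene {} e [y, n] v) \<longleftrightarrow> R n" for y n
    unfolding P(2) using exists_least_iff[of "\<lambda>t. P t n"] by simp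
  then show ?thesis by blast
qed

text \<open>
  The other half of Post's theorem: for a \<open>\<Sigma>\<^sup>0\<^sub>2\<close> predicate \<open>\<exists>y. \<forall>z. P z y n\<close>, the
  halting problem decides the inner part, since \<open>smn e (y, n)\<close> is an index of a function that
  searches for a counterexample \<open>z\<close> and ignores its argument. A search for \<open>y\<close> with this
  oracle then converges exactly if the predicate holds.
\<close>

lemma ex_index_of_sigma_2:
  assumes "sigma 2 R" shows "\<exists>e. \<forall>y n. (\<exists>v. kleene {n. n \<in> W {} n} e [y, n] v) \<longleftrightarrow> R n"
proof -
  let ?K = "{n. n \<in> W {} n}"
  obtain P where P: "decidable_in {} (\<lambda>p. P (pfst p) (pfst (psnd p)) (psnd (psnd p)))"
    "\<And>n. R n \<longleftrightarrow> (\<exists>y. \<forall>z. P z y n)"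
    using assms unfolding sigma_2_iff by blast
  have "sigma 1 (\<lambda>p. \<exists>z. \<not> P z (pfst p) (psnd p))"
    by (rule sigma1I[of "\<lambda>z p. \<not> P z (pfst p) (psnd p)"]) (auto intro: decidable_in_not P(1))
  from ex_index_of_sigma_1[OF this] obtain e where
    e: "\<And>y p. (\<exists>v. kleene {} e [y, p] v) \<longleftrightarrow> (\<exists>z. \<not> P z (pfst p) (psnd p))" by auto
  \<comment> \<open>Membership of \<open>smn e p\<close> in the halting problem concerns convergence at the argument \<open>smn e p\<close>,
    which is irrelevant to the search.\<close>
  have K: "smn e p \<in> ?K \<longleftrightarrow> (\<exists>z. \<not> P z (pfst p) (psnd p))" for p
    unfolding mem_Collect_eq W_iff kleene_smn by (rule e)
  have "kleene ?K (list_encode [3]) [x] (if x \<in> ?K then 1 else 0)" for x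
    by (rule kleene.query)
  then have dec: "decidable_in ?K (\<lambda>x. x \<in> ?K)"
    unfolding decidable_in_def recursive_in_def by blast
  have "decidable_in ?K (\<lambda>z. smn e (prod_encode (pfst z, psnd (psnd z))) \<notin> ?K)"
    by (rule decidable_in_not[OF decidable_in_comp[OF dec]]) (intro recursive_in_smn recursive_intros)
  from ex_search_index[of ?K "\<lambda>t y n. smn e (prod_encode (t, n)) \<notin> ?K", OF this]
  obtain s where s: "\<And>y n t. kleene ?K s [y, n] t \<longleftrightarrow>
      smn e (prod_encode (t, n)) \<notin> ?K \<and> (\<forall>m<t. \<not> smn e (prod_encode (m, n)) \<notin> ?K)" by blast
  have "(\<exists>v. kleene ?K s [y, n] v) \<longleftrightarrow> (\<exists>t. smn e (prod_encode (t, n)) \<notin> ?K)" for y n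
    unfolding s using exists_least_iff[of "\<lambda>t. smn e (prod_encode (t, n)) \<notin> ?K"] by blast
  then have "(\<exists>v. kleene ?K s [y, n] v) \<longleftrightarrow> R n" for y n
    unfolding K P(2) by simp
  then show ?thesis by blast
qed

lemma ex_index_of_sigma:
  "sigma l R \<Longrightarrow> l \<in> {1, 2} \<Longrightarrow> \<exists>e. \<forall>y n. (\<exists>v. kleene (oracle_set l) e [y, n] v) \<longleftrightarrow> R n"
  using ex_index_of_sigma_1 ex_index_of_sigma_2 oracle_set_simps by auto

section \<open>Racing two sets against each other\<close>

lemma sim_commute: "sim l A B \<longleftrightarrow> sim l B A"
  unfolding sim_def by (auto simp: Un_commute)

lemma sim_phi_if_eventually_eq:
  assumes "\<And>y v. N \<le> y \<Longrightarrow> (y, v) \<in> phi Z e \<longleftrightarrow> (y, v) \<in> phi Z f"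
  shows "sim 2 (phi Z e) (phi Z f)"
proof -
  have fin: "finite {(y, v). (y, v) \<in> phi Z e \<and> y < N}" for e
  proof (rule finite_subset)
    show "{(y, v). (y, v) \<in> phi Z e \<and> y < N} \<subseteq> (\<lambda>y. (y, THE v. (y, v) \<in> phi Z e)) ` {..<N}"
    proof clarify
      fix y v assume y: "(y, v) \<in> phi Z e" "y < N"
      then have "(THE v. (y, v) \<in> phi Z e) = v"
        using single_valued_phi by (intro the_equality) (auto dest: single_valuedD)
      then show "(y, v) \<in> (\<lambda>y. (y, THE v. (y, v) \<in> phi Z e)) ` {..<N}" using y(2) by (intro image_eqI[of _ _ y]) auto
    qed
  qed simp
  have "(phi Z e - phi Z f) \<union> (phi Z f - phi Z e) \<subseteq>
      {(y, v). (y, v) \<in> phi Z e \<and> y < N} \<union> {(y, v). (y, v) \<in> phi Z f \<and> y < N}"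
    using assms by (auto simp: not_le[symmetric])
  then have "finite ((phi Z e - phi Z f) \<union> (phi Z f - phi Z e))"
    by (rule finite_subset) (intro finite_UnI fin)
  then show ?thesis by (simp add: sim_def)
qed

lemma sim_phi_imp_sim_W:
  assumes "sim l (phi Z e) (phi Z f)" shows "sim l (W Z e) (W Z f)"
proof (cases "l = 1")
  case True
  then show ?thesis using assms by (simp add: sim_def W_def)
next
  case False
  then have "finite (Domain ((phi Z e - phi Z f) \<union> (phi Z f - phi Z e)))"
    using assms by (simp add: sim_def finite_Domain)
  moreover have "(W Z e - W Z f) \<union> (W Z f - W Z e) \<subseteq> Domain ((phi Z e - phi Z f) \<union> (phi Z f - phi Z e))"
    unfolding W_def by blast
  ultimately show ?thesis using False by (auto simp: sim_def intro: finite_subset)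
qed

lemma phi_smn: "(y, v) \<in> phi Z (smn d p) \<longleftrightarrow> kleene Z d [y, p] v"
  by (simp add: phi_def kleene_smn)

text \<open>
  Search for the first stage at which \<open>R p\<close> or \<open>S p\<close> is confirmed, and then behave like
  \<open>\<phi>\<close> with index \<open>b p\<close> or \<open>a p\<close>, according to which of the two it was.
\<close>

lemma ex_sigma_race_1:
  assumes "sigma 1 R" "sigma 1 S" "recursive_in {} a" "recursive_in {} b"
  shows "\<exists>d. \<forall>p. (R p \<and> \<not> S p \<longrightarrow> sim 1 (phi {} (smn d p)) (phi {} (b p))) \<and>
                (\<not> R p \<and> S p \<longrightarrow> sim 1 (phi {} (smn d p)) (phi {} (a p)))"
proof -
  obtain P where P: "decidable_in {} (\<lambda>z. P (pfst z) (psnd z))" "\<And>p. R p \<longleftrightarrow> (\<exists>t. P t p)"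
    using assms(1) unfolding sigma_1_iff by blast
  obtain Q where Q: "decidable_in {} (\<lambda>z. Q (pfst z) (psnd z))" "\<And>p. S p \<longleftrightarrow> (\<exists>t. Q t p)"
    using assms(2) unfolding sigma_1_iff by blast
  have "decidable_in {} (\<lambda>z. P (pfst z) (psnd z) \<or> Q (pfst z) (psnd z))"
    by (intro decidable_in_disj P(1) Q(1))
  moreover have "decidable_in {} (\<lambda>z. (\<lambda>z. P (pfst z) (psnd z)) (prod_encode (pfst z, psnd (psnd z))))"
    by (intro decidable_in_comp[OF P(1)] recursive_intros)
  then have "recursive_in {} (\<lambda>z. if P (pfst z) (psnd (psnd z)) then b (psnd (psnd z)) else a (psnd (psnd z)))"
    by (intro recursive_in_if recursive_in_comp[OF assms(3)] recursive_in_comp[OF assms(4)]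
        recursive_in_psnd recursive_in_id) simp
  ultimately obtain d where d: "\<And>y p v. kleene {} d [y, p] v \<longleftrightarrow>
      (\<exists>t. (P t p \<or> Q t p) \<and> (\<forall>m<t. \<not> (P m p \<or> Q m p)) \<and> kleene {} (if P t p then b p else a p) [y] v)"
    using ex_search_apply_index[of "\<lambda>t p. P t p \<or> Q t p" "\<lambda>t y p. if P t p then b p else a p"] by auto
  have least: "\<exists>t. (P t p \<or> Q t p) \<and> (\<forall>m<t. \<not> (P m p \<or> Q m p))" if "R p \<or> S p" for p
    using that exists_least_iff[of "\<lambda>t. P t p \<or> Q t p"] unfolding P(2) Q(2) by blast
  have "phi {} (smn d p) = phi {} (b p)" if "R p" "\<not> S p" for p
  proof -
    have "kleene {} d [y, p] v \<longleftrightarrow> kleene {} (b p) [y] v" for y v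
      using least[of p] that unfolding d P(2) Q(2) by auto
    then show ?thesis by (auto simp: phi_def kleene_smn)
  qed
  moreover have "phi {} (smn d p) = phi {} (a p)" if "\<not> R p" "S p" for p
  proof -
    have "kleene {} d [y, p] v \<longleftrightarrow> kleene {} (a p) [y] v" for y v
      using least[of p] that unfolding d P(2) Q(2) by auto
    then show ?thesis by (auto simp: phi_def kleene_smn)
  qed
  ultimately show ?thesis by (intro exI[of _ d]) (simp add: sim_def)
qed

text \<open>
  Boundedly many refutable universal statements are all refuted below a common bound.
\<close>

lemma ex_bound_of_counterexamples:
  assumes "\<And>u. \<exists>z. \<not> P z u" shows "\<exists>N. \<forall>u\<le>(w::nat). \<exists>z<N. \<not> P (z::nat) u"
proof -
  obtain z where z: "\<And>u. \<not> P (z u) u" using assms by metis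
  have "\<exists>x<Suc (Max (z ` {..w})). \<not> P x u" if "u \<le> w" for u
    using that z[of u] by (intro exI[of _ "z u"]) (simp add: less_Suc_eq_le)
  then show ?thesis by blast
qed

text \<open>
  At argument \<open>y\<close>, all information about \<open>R p\<close> and \<open>S p\<close> comes from quantifiers bounded by
  \<open>y\<close>, and the smaller surviving witness wins. If exactly one of the two predicates holds then,
  from some \<open>y\<close> on, its least true witness survives and all smaller or equal candidates for
  the other one have been refuted. So the choice between \<open>a p\<close> and \<open>b p\<close> is right at all but
  finitely many \<open>y\<close>, which is all that \<open>\<sim>\<^sub>2\<close> asks for. No waiting is needed here.
\<close>

lemma ex_sigma_race_2:
  assumes "sigma 2 R" "sigma 2 S" "recursive_in {} a" "recursive_in {} b"
  shows "\<exists>d. \<forall>p. (R p \<and> \<not> S p \<longrightarrow> sim 2 (phi {} (smn d p)) (phi {} (b p))) \<and>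
                (\<not> R p \<and> S p \<longrightarrow> sim 2 (phi {} (smn d p)) (phi {} (a p)))"
proof -
  obtain P where P: "decidable_in {} (\<lambda>p. P (pfst p) (pfst (psnd p)) (psnd (psnd p)))"
      "\<And>p. R p \<longleftrightarrow> (\<exists>u. \<forall>z. P z u p)"
    using assms(1) unfolding sigma_2_iff by blast
  obtain Q where Q: "decidable_in {} (\<lambda>p. Q (pfst p) (pfst (psnd p)) (psnd (psnd p)))"
      "\<And>p. S p \<longleftrightarrow> (\<exists>u. \<forall>z. Q z u p)"
    using assms(2) unfolding sigma_2_iff by blast
  \<comment> \<open>\<open>guess\<close> holds if \<open>R p\<close> looks more likely than \<open>S p\<close> at stage \<open>y\<close>.\<close>
  define guess where "guess y p \<longleftrightarrow>
    (\<exists>u<y. (\<forall>z<y. P z u p) \<and> (\<forall>w<u. \<exists>z<y. \<not> Q z w p))" for y p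
  have Pc: "decidable_in {} (\<lambda>x. P (f x) (g x) (h x))" if "recursive_in {} f" "recursive_in {} g" "recursive_in {} h" for f g h
    using decidable_in_comp[OF P(1), of "\<lambda>x. prod_encode (f x, prod_encode (g x, h x))"] that
    by (simp add: recursive_in_prod_encode)
  have Qc: "decidable_in {} (\<lambda>x. Q (f x) (g x) (h x))" if "recursive_in {} f" "recursive_in {} g" "recursive_in {} h" for f g h
    using decidable_in_comp[OF Q(1), of "\<lambda>x. prod_encode (f x, prod_encode (g x, h x))"] that
    by (simp add: recursive_in_prod_encode)
  \<comment> \<open>The search is trivial: it stops at \<open>t = 0\<close>.\<close>
  have dec: "decidable_in {} (\<lambda>z. pfst z = 0)" by (intro recursive_intros)
  have rec: "recursive_in {} (\<lambda>z. if guess (pfst (psnd z)) (psnd (psnd z)) then b (psnd (psnd z)) else a (psnd (psnd z)))"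
    unfolding guess_def
    by (intro recursive_intros Pc Qc recursive_in_comp[OF assms(3)] recursive_in_comp[OF assms(4)])
  obtain d where d: "\<And>y p v. kleene {} d [y, p] v \<longleftrightarrow>
      kleene {} (if guess y p then b p else a p) [y] v"
    using ex_search_apply_index[of "\<lambda>t p. t = 0" "\<lambda>t y p. if guess y p then b p else a p", OF dec rec]
    by auto
  have "sim 2 (phi {} (smn d p)) (phi {} (b p))" if R: "R p" and S: "\<not> S p" for p
  proof -
    obtain u where u: "\<And>z. P z u p" using R P(2) by blast
    obtain N where N: "\<And>w. w \<le> u \<Longrightarrow> \<exists>z<N. \<not> Q z w p"
      using ex_bound_of_counterexamples[of "\<lambda>z w. Q z w p" u] S unfolding Q(2) by blast
    have "guess y p" if "max N (Suc u) \<le> y" for y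
      unfolding guess_def
    proof (rule exI[of _ u], intro conjI allI impI)
      fix w assume "w < u"
      then obtain z where "z < N" "\<not> Q z w p" using N[of w] by auto
      then show "\<exists>z<y. \<not> Q z w p" using that by (intro exI[of _ z]) simp
    qed (use u that in auto)
    then show ?thesis
      by (intro sim_phi_if_eventually_eq[of "max N (Suc u)"]) (simp add: phi_smn d, simp add: phi_def)
  qed
  moreover have "sim 2 (phi {} (smn d p)) (phi {} (a p))" if R: "\<not> R p" and S: "S p" for p
  proof -
    obtain w where w: "\<And>z. Q z w p" using S Q(2) by blast
    obtain N where N: "\<And>u. u \<le> w \<Longrightarrow> \<exists>z<N. \<not> P z u p"
      using ex_bound_of_counterexamples[of "\<lambda>z u. P z u p" w] R unfolding P(2) by blast
    have "\<not> guess y p" if "N \<le> y" for y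
    proof
      assume "guess y p"
      then obtain u where u: "\<forall>z<y. P z u p" "\<forall>w<u. \<exists>z<y. \<not> Q z w p" unfolding guess_def by blast
      then have "u \<le> w" using w by (meson not_le)
      then show False using N[of u] u(1) that by (meson less_le_trans)
    qed
    then show ?thesis
      by (intro sim_phi_if_eventually_eq[of N]) (simp add: phi_smn d, simp add: phi_def)
  qed
  ultimately show ?thesis by blast
qed

lemma ex_sigma_race:
  assumes "l \<in> {1, 2}" "sigma l R" "sigma l S" "recursive_in {} a" "recursive_in {} b"
  shows "\<exists>d. \<forall>p. (R p \<and> \<not> S p \<longrightarrow> sim l (phi {} (smn d p)) (phi {} (b p))) \<and>
                (\<not> R p \<and> S p \<longrightarrow> sim l (phi {} (smn d p)) (phi {} (a p)))"
proof (cases "l = 1")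
  case True
  show ?thesis using ex_sigma_race_1[OF assms(2-5)[unfolded True]] unfolding True .
next
  case False
  then have l: "l = 2" using assms(1) by simp
  show ?thesis using ex_sigma_race_2[OF assms(2-5)[unfolded l]] unfolding l .
qed

section \<open>Productive functions\<close>

lemma computable_1_iff: "computable 1 (\<lambda>xs. f (hd xs)) \<longleftrightarrow> recursive_in {} f"
proof -
  have "(\<forall>xs. length xs = 1 \<longrightarrow> kleene {} e xs (f (hd xs))) \<longleftrightarrow> (\<forall>x. kleene {} e [x] (f x))" for e
    by (auto simp: length_Suc_conv)
  then show ?thesis unfolding computable_def recursive_in_def by simp
qed

text \<open>
  \<open>H\<close> maps a tuple of indices to a number on which each \<open>A i\<close> agrees with the set that the
  \<open>i\<close>-th index enumerates in the oracle.
\<close>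

definition productive :: "nat \<Rightarrow> nat \<Rightarrow> (nat \<Rightarrow> nat set) \<Rightarrow> (nat list \<Rightarrow> nat) \<Rightarrow> bool" where
  "productive l s A H \<longleftrightarrow> computable s H \<and>
    (\<forall>xs. length xs = s \<longrightarrow> (\<forall>i<s. H xs \<in> A i \<longleftrightarrow> H xs \<in> W (oracle_set l) (xs ! i)))"

text \<open>
  A reduction to \<open>A\<close> is itself computed by some index \<open>e\<close>. It suffices to reduce a tuple
  \<open>X\<close> whose elements \<open>(e, xs)\<close> mention this index, so that \<open>X\<close> can refer to its own
  reduction: \<open>(e, xs) \<in> X i\<close> says that the value of \<open>\<phi>\<^sub>e\<close> at \<open>(e, xs)\<close> belongs to the
  set with index \<open>xs ! i\<close>.
\<close>

lemma m_complete_imp_productive: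
  assumes l: "l \<in> {1, 2}" and complete: "m_complete l s A"
  shows "\<exists>H. productive l s A H"
proof -
  define X where "X i = {p. \<exists>d. halts_in (pfst p) p d \<and> result d \<in> W (oracle_set l) (code_nth (psnd p) i)}" for i
  have "Sigma0 l (X i)" for i
  proof -
    have "sigma l (\<lambda>q. psnd (prod_encode (code_nth (psnd (psnd q)) i, result (pfst q))) \<in>
        W (oracle_set l) (pfst (prod_encode (code_nth (psnd (psnd q)) i, result (pfst q)))))"
      by (rule sigma_comp[OF sigma_W[OF l] _ l]) (intro code_intros recursive_in_result)
    then have "sigma l (\<lambda>q. result (pfst q) \<in> W (oracle_set l) (code_nth (psnd (psnd q)) i))" by simp
    moreover have "decidable_in {} (\<lambda>q. halts_in (pfst (psnd q)) (psnd q) (pfst q))"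
      by (intro decidable_in_halts_in recursive_intros)
    ultimately have "sigma l (\<lambda>p. p \<in> X i)"
      unfolding X_def mem_Collect_eq
      using sigma_ex_conj[of "\<lambda>d p. halts_in (pfst p) p d" l
          "\<lambda>d p. result d \<in> W (oracle_set l) (code_nth (psnd p) i)"] l by blast
    then show ?thesis using Sigma0_iff_sigma[OF l] by simp
  qed
  then have "m_reducible_sets s X A" using complete unfolding m_complete_def by blast
  then obtain f where f: "recursive_in {} f" "\<And>n i. i < s \<Longrightarrow> n \<in> X i \<longleftrightarrow> f n \<in> A i"
    unfolding m_reducible_sets_def computable_1_iff by blast
  obtain e where e: "\<And>x. kleene {} e [x] (f x)" using f(1) unfolding recursive_in_def by blast
  let ?H = "\<lambda>xs. f (prod_encode (e, list_encode xs))"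
  have "productive l s A ?H" unfolding productive_def
  proof (intro conjI allI impI)
    show "computable s ?H" unfolding computable_iff_computable_in
      by (intro computable_in_of_recursive_in[OF f(1)] computable_in_prod_encode
          computable_in_const computable_in_list_encode)
  next
    fix xs :: "nat list" and i assume xs: "length xs = s" "i < s"
    let ?p = "prod_encode (e, list_encode xs)"
    have "kleene {} e [?p] v \<longleftrightarrow> v = f ?p" for v using e kleene_deterministic by blast
    then have "?p \<in> X i \<longleftrightarrow> f ?p \<in> W (oracle_set l) (xs ! i)"
      using xs unfolding X_def kleene_iff_halts_in by auto metis+
    then show "?H xs \<in> A i \<longleftrightarrow> ?H xs \<in> W (oracle_set l) (xs ! i)" using f(2)[OF xs(2)] by simp
  qed
  then show ?thesis by blast
qed

text \<open>
  Feed \<open>H\<close> with indices of sets that are everything or empty, according to whether \<open>n \<in> X i\<close>.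
\<close>

lemma productive_imp_m_complete:
  assumes l: "l \<in> {1, 2}" and A: "\<forall>i<s. Sigma0 l (A i)" and H: "productive l s A H"
  shows "m_complete l s A"
  unfolding m_complete_def
proof (intro conjI A allI impI)
  fix X assume X: "\<forall>i<s. Sigma0 l (X i)"
  have "\<exists>e. \<forall>y n. (\<exists>v. kleene (oracle_set l) e [y, n] v) \<longleftrightarrow> n \<in> X i" if "i < s" for i
    using X that Sigma0_iff_sigma[OF l] ex_index_of_sigma[OF _ l] by blast
  then obtain e where e: "\<And>i y n. i < s \<Longrightarrow> (\<exists>v. kleene (oracle_set l) (e i) [y, n] v) \<longleftrightarrow> n \<in> X i"
    by metis
  let ?f = "\<lambda>n. H (map (\<lambda>i. smn (e i) n) [0..<s])"
  have "recursive_in {} ?f"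
    using H unfolding productive_def computable_iff_computable_in
    by (intro recursive_in_map recursive_in_smn recursive_intros) simp
  moreover have "n \<in> X i \<longleftrightarrow> ?f n \<in> A i" if "i < s" for n i
  proof -
    have "?f n \<in> A i \<longleftrightarrow> ?f n \<in> W (oracle_set l) (smn (e i) n)"
      using H that unfolding productive_def by simp
    then show ?thesis using e[OF that] by (simp add: W_iff kleene_smn)
  qed
  ultimately show "m_reducible_sets s X A"
    unfolding m_reducible_sets_def computable_1_iff by blast
qed

section \<open>Fixed-point free functions\<close>

text \<open>
  Indices of a total function and of the nowhere defined function (the search for a zero of the
  successor function).
\<close>

definition full_index :: nat where "full_index = list_encode [0]"
definition empty_index :: nat where "empty_index = list_encode [6, list_encode [1]]"

lemma W_full_index: "W Z full_index = UNIV"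
  by (auto simp: W_iff full_index_def kleene_iff)

lemma W_empty_index: "W Z empty_index = {}"
  by (auto simp: W_iff empty_index_def kleene_iff(8) kleene_iff(2)[unfolded One_nat_def])

text \<open>
  For \<open>l = 1\<close>, \<open>P e\<close> says that \<open>W {} e\<close> is nonempty, and the empty set differs from \<open>W {} e\<close> in
  this case, the full set otherwise. For \<open>l = 2\<close>, \<open>P e\<close> says that \<open>W {} e\<close> is finite, and
  then the full set is not similar to it, whereas otherwise the empty set is not.
\<close>

lemma ex_sigma_separation:
  assumes l: "l \<in> {1, 2}"
  shows "\<exists>P a b. sigma l P \<and>
    (\<forall>e. (P e \<longrightarrow> \<not> sim l (W {} a) (W {} e)) \<and> (\<not> P e \<longrightarrow> \<not> sim l (W {} b) (W {} e)))"
proof (cases "l = 1")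
  case True
  have "sigma 1 (\<lambda>e. W {} e \<noteq> {})"
  proof (rule sigma1I)
    show "decidable_in {} (\<lambda>p. (\<lambda>y e. halts_in e (pfst y) (psnd y)) (pfst p) (psnd p))"
      by (intro decidable_in_halts_in recursive_intros)
    show "W {} e \<noteq> {} \<longleftrightarrow> (\<exists>y. halts_in e (pfst y) (psnd y))" for e
      by (metis W_iff_halts_in empty_iff equals0I pfst_prod_encode psnd_prod_encode)
  qed
  moreover have "\<not> sim 1 (W {} empty_index) (W {} e)" if "W {} e \<noteq> {}" for e
    using that by (auto simp: sim_def W_empty_index)
  moreover have "\<not> sim 1 (W {} full_index) (W {} e)" if "\<not> W {} e \<noteq> {}" for e
    using that by (auto simp: sim_def W_full_index)
  ultimately show ?thesis unfolding True by blast
next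
  case False
  then have l: "l = 2" using assms by simp
  have "sigma 2 (\<lambda>e. finite (W {} e))"
  proof (rule sigma2I)
    show "decidable_in {} (\<lambda>p. (\<lambda>z y e. pfst z < y \<or> \<not> halts_in e (pfst z) (psnd z))
        (pfst p) (pfst (psnd p)) (psnd (psnd p)))"
      by (intro decidable_in_halts_in recursive_intros)
    fix e
    have "finite (W {} e) \<longleftrightarrow> (\<exists>y. \<forall>x\<in>W {} e. x < y)"
      by (rule finite_nat_set_iff_bounded)
    also have "\<dots> \<longleftrightarrow> (\<exists>y. \<forall>z. pfst z < y \<or> \<not> halts_in e (pfst z) (psnd z))"
      unfolding Ball_def W_iff_halts_in by (metis pfst_prod_encode psnd_prod_encode)
    finally show "finite (W {} e) \<longleftrightarrow> (\<exists>y. \<forall>z. pfst z < y \<or> \<not> halts_in e (pfst z) (psnd z))" .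
  qed
  moreover have "\<not> sim 2 (W {} full_index) (W {} e)" if "finite (W {} e)" for e
    using Diff_infinite_finite[OF that infinite_UNIV_nat] by (simp add: sim_def W_full_index)
  moreover have "\<not> sim 2 (W {} empty_index) (W {} e)" if "\<not> finite (W {} e)" for e
    using that by (simp add: sim_def W_empty_index)
  ultimately show ?thesis unfolding l by blast
qed

lemma m_complete_imp_fixed_point_free:
  assumes l: "l \<in> {1, 2}" and complete: "m_complete l s A"
  shows "\<exists>F. m_reducible_funs s F A \<and>
    (\<forall>i<s. \<forall>xs. length xs = s \<longrightarrow> \<not> sim l (W {} (F i xs)) (W {} (xs ! i)))"
proof -
  obtain P a b where P: "sigma l P" "\<And>e. P e \<Longrightarrow> \<not> sim l (W {} a) (W {} e)"
    "\<And>e. \<not> P e \<Longrightarrow> \<not> sim l (W {} b) (W {} e)"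
    using ex_sigma_separation[OF l] by blast
  define X where "X i = {c. P (code_nth c i)}" for i
  have "sigma l (\<lambda>c. P (code_nth c i))" for i
    by (rule sigma_comp[OF P(1) _ l]) (intro code_intros)
  then have "Sigma0 l (X i)" for i unfolding Sigma0_iff_sigma[OF l] X_def by simp
  then have "m_reducible_sets s X A" using complete unfolding m_complete_def by blast
  then obtain f where f: "recursive_in {} f" "\<And>n i. i < s \<Longrightarrow> n \<in> X i \<longleftrightarrow> f n \<in> A i"
    unfolding m_reducible_sets_def computable_1_iff by blast
  define h where "h xs = f (list_encode xs)" for xs
  have h: "h xs \<in> A i \<longleftrightarrow> P (xs ! i)" if "length xs = s" "i < s" for xs i
    using f(2)[OF that(2), of "list_encode xs"] that by (simp add: X_def h_def)
  define F where "F i xs = (if h xs \<in> A i then a else b)" for i xs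
  have "computable s h" unfolding h_def computable_iff_computable_in
    by (intro computable_in_of_recursive_in[OF f(1)] computable_in_list_encode)
  moreover have "computable s (\<lambda>xs. c)" for c
    unfolding computable_iff_computable_in by (rule computable_in_const)
  ultimately have "m_reducible_funs s F A"
    unfolding m_reducible_funs_def F_def
    by (intro exI[of _ h] exI[of _ "\<lambda>i xs. a"] exI[of _ "\<lambda>i xs. b"]) simp
  moreover have "\<not> sim l (W {} (F i xs)) (W {} (xs ! i))" if "i < s" "length xs = s" for i xs
    using P(2,3) h[OF that(2,1)] by (simp add: F_def)
  ultimately show ?thesis by blast
qed

text \<open>
  Given \<open>X\<close>, tuples \<open>xs\<close> of indices \<open>x\<^sub>i\<close> are built that depend on \<open>n\<close> such that \<open>\<phi>\<close> at \<open>x\<^sub>i\<close> is similar to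
  \<open>\<phi>\<close> at \<open>b i xs\<close> if \<open>n \<in> X i\<close> and \<open>h xs \<notin> A i\<close>, and to \<open>\<phi>\<close> at \<open>a i xs\<close> if
  \<open>n \<notin> X i\<close> and \<open>h xs \<in> A i\<close>. In both cases it would be similar to \<open>\<phi>\<close> at \<open>F i xs\<close>, which
  is excluded, so \<open>n \<in> X i\<close> iff \<open>h xs \<in> A i\<close>.
\<close>

lemma fixed_point_free_imp_m_complete:
  assumes l: "l \<in> {1, 2}" and A: "\<forall>i<s. Sigma0 l (A i)" and red: "m_reducible_funs s F A"
    and F: "\<And>i xs. i < s \<Longrightarrow> length xs = s \<Longrightarrow> \<not> sim l (phi {} (F i xs)) (phi {} (xs ! i))"
  shows "m_complete l s A"
  unfolding m_complete_def
proof (intro conjI A allI impI)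
  fix X assume X: "\<forall>i<s. Sigma0 l (X i)"
  obtain h a b where h: "computable s h" and ab: "\<And>i. i < s \<Longrightarrow> computable s (a i)" "\<And>i. i < s \<Longrightarrow> computable s (b i)"
    and hab: "\<And>i xs. i < s \<Longrightarrow> length xs = s \<Longrightarrow> F i xs = (if h xs \<in> A i then a i xs else b i xs)"
    using red unfolding m_reducible_funs_def by blast
  \<comment> \<open>The simultaneous recursion theorem by self-application: if \<open>p\<close> pairs the code of a list of
    indices \<open>d\<^sub>j\<close> with \<open>n\<close>, then \<open>G p\<close> is the tuple of the \<open>smn d\<^sub>j p\<close>, so that each of the
    functions with these indices knows the whole tuple.\<close>
  define G where "G p = map (\<lambda>j. smn (code_nth (pfst p) j) p) [0..<s]" for p
  have G: "recursive_in {} (\<lambda>p. f (G p))" if "computable s f" for f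
    using that unfolding G_def computable_iff_computable_in
    by (intro recursive_in_map recursive_in_smn code_intros)
  have "\<exists>d. \<forall>p. (psnd p \<in> X i \<and> h (G p) \<notin> A i \<longrightarrow> sim l (phi {} (smn d p)) (phi {} (b i (G p)))) \<and>
      (psnd p \<notin> X i \<and> h (G p) \<in> A i \<longrightarrow> sim l (phi {} (smn d p)) (phi {} (a i (G p))))" if i: "i < s" for i
  proof (rule ex_sigma_race[OF l])
    have "sigma l (\<lambda>n. n \<in> X i)" "sigma l (\<lambda>n. n \<in> A i)"
      using X A i Sigma0_iff_sigma[OF l] by blast+
    then show "sigma l (\<lambda>p. psnd p \<in> X i)" "sigma l (\<lambda>p. h (G p) \<in> A i)"
      using sigma_comp[OF _ recursive_in_psnd[OF recursive_in_id] l] sigma_comp[OF _ G[OF h] l] by blast+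
  qed (intro G ab i)+
  then obtain d where d:
    "\<And>i p. i < s \<Longrightarrow> psnd p \<in> X i \<Longrightarrow> h (G p) \<notin> A i \<Longrightarrow> sim l (phi {} (smn (d i) p)) (phi {} (b i (G p)))"
    "\<And>i p. i < s \<Longrightarrow> psnd p \<notin> X i \<Longrightarrow> h (G p) \<in> A i \<Longrightarrow> sim l (phi {} (smn (d i) p)) (phi {} (a i (G p)))"
    by metis
  define c where "c = list_encode (map d [0..<s])"
  let ?f = "\<lambda>n. h (G (prod_encode (c, n)))"
  have "recursive_in {} ?f" by (rule recursive_in_comp[OF G[OF h]]) (intro recursive_intros)
  moreover have "n \<in> X i \<longleftrightarrow> ?f n \<in> A i" if i: "i < s" for n i
  proof -
    let ?p = "prod_encode (c, n)"
    have Gi: "length (G ?p) = s" "G ?p ! i = smn (d i) ?p" using i by (simp_all add: G_def c_def)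
    have "\<not> sim l (phi {} (smn (d i) ?p)) (phi {} (F i (G ?p)))"
      using F[OF i Gi(1)] unfolding Gi(2) sim_commute[of l "phi {} (F i (G ?p))"] .
    then show ?thesis
      using d[OF i, of ?p] hab[OF i Gi(1)] by (cases "n \<in> X i"; cases "?f n \<in> A i") auto
  qed
  ultimately show "m_reducible_sets s X A"
    unfolding m_reducible_sets_def computable_1_iff by blast
qed

section \<open>The equivalences\<close>

theorem proposition3:
  fixes s l :: nat and A :: "nat \<Rightarrow> nat set"
  assumes "s \<ge> 1" and "l \<in> {1, 2}" and "\<forall>i<s. Sigma0 l (A i)"
  shows "(m_complete l s A \<longleftrightarrow>
      (\<exists>H. computable s H \<and>
        (\<forall>xs. length xs = s \<longrightarrow>
          H xs \<in> (\<Inter>i\<in>{..<s}. (A i \<inter> W (oracle_set l) (xs ! i)) \<union>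
                                    (- A i \<inter> - W (oracle_set l) (xs ! i))))))
    \<and> (m_complete l s A \<longleftrightarrow>
      (\<exists>F. m_reducible_funs s F A \<and>
        (\<forall>i<s. \<forall>xs. length xs = s \<longrightarrow> \<not> sim l (W {} (F i xs)) (W {} (xs ! i)))))
    \<and> (m_complete l s A \<longleftrightarrow>
      (\<exists>F. m_reducible_funs s F A \<and>
        (\<forall>i<s. \<forall>xs. length xs = s \<longrightarrow> \<not> sim l (phi {} (F i xs)) (phi {} (xs ! i)))))"
proof (intro conjI)
  have "computable s H \<and> (\<forall>xs. length xs = s \<longrightarrow>
      H xs \<in> (\<Inter>i\<in>{..<s}. (A i \<inter> W (oracle_set l) (xs ! i)) \<union>
        (- A i \<inter> - W (oracle_set l) (xs ! i)))) \<longleftrightarrow> productive l s A H" for H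
    unfolding productive_def by auto
  then show "m_complete l s A \<longleftrightarrow>
      (\<exists>H. computable s H \<and>
        (\<forall>xs. length xs = s \<longrightarrow>
          H xs \<in> (\<Inter>i\<in>{..<s}. (A i \<inter> W (oracle_set l) (xs ! i)) \<union>
                                    (- A i \<inter> - W (oracle_set l) (xs ! i)))))"
    using m_complete_imp_productive[OF assms(2)] productive_imp_m_complete[OF assms(2,3)] by simp blast
next
  show "m_complete l s A \<longleftrightarrow>
      (\<exists>F. m_reducible_funs s F A \<and>
        (\<forall>i<s. \<forall>xs. length xs = s \<longrightarrow> \<not> sim l (W {} (F i xs)) (W {} (xs ! i))))"
    using m_complete_imp_fixed_point_free[OF assms(2)] fixed_point_free_imp_m_complete[OF assms(2,3)]
      sim_phi_imp_sim_W by metis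
  show "m_complete l s A \<longleftrightarrow>
      (\<exists>F. m_reducible_funs s F A \<and>
        (\<forall>i<s. \<forall>xs. length xs = s \<longrightarrow> \<not> sim l (phi {} (F i xs)) (phi {} (xs ! i))))"
    using m_complete_imp_fixed_point_free[OF assms(2)] fixed_point_free_imp_m_complete[OF assms(2,3)]
      sim_phi_imp_sim_W by metis
qed

end
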